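(* There does not exist any real hypersurface $M$ in $M_n(c)$ ($n>2$, $c=\pm1$) whose structure Jacobi operator $R_\xi$ is of Codazzi type, i.e. satisfies $(\nabla_XR_\xi)Y=(\nabla_YR_\xi)X$ for all $X,Y\in\Gamma(TM)$.
   Context: $M_n(c)$ is the $n$-dimensional (complex dimension) non-flat complex space form of constant holomorphic sectional curvature $4c$, with complex structure $J$; throughout $c=\pm1$, $n>2$ and everything is $C^\infty$. For $c>0$ it is the complex projective space $CP^n$, for $c<0$ the complex hyperbolic space $CH^n$. A real hypersurface $M$ in $M_n(c)$ is a connected hypersurface of real codimension one, without boundary; only local properties are studied, so $M$ is not distinguished from its open subsets. $N$ is a (locally defined) unit normal field, $\nabla$ the Levi-Civita connection of the induced metric on $M$, and $\xi=-JN$. The curvature tensor of $M$ is $R(X,Y)Z=\nabla_X\nabla_YZ-\nabla_Y\nabla_XZ-\nabla_{[X,Y]}Z$, and the structure Jacobi operator is $R_\xi(Y)=R(Y,\xi)\xi$. *)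

theory Defs
  imports "HOL-Analysis.Analysis"
begin

section \<open>Smooth maps on open subsets of normed spaces\<close>

primrec k_smooth_on ::
  "nat \<Rightarrow> 'a::real_normed_vector set \<Rightarrow> ('a \<Rightarrow> 'b::real_normed_vector) \<Rightarrow> bool" where
  "k_smooth_on 0 U f \<longleftrightarrow> continuous_on U f"
| "k_smooth_on (Suc k) U f \<longleftrightarrow>
     f differentiable_on U \<and> (\<forall>v. k_smooth_on k U (\<lambda>u. frechet_derivative f (at u) v))"

text \<open>Meant for open \<open>U\<close> in a finite-dimensional space, where it is \<open>C\<close>-infinity smoothness.\<close>

definition smooth_on ::
  "'a::real_normed_vector set \<Rightarrow> ('a \<Rightarrow> 'b::real_normed_vector) \<Rightarrow> bool" where
  "smooth_on U f \<longleftrightarrow> (\<forall>k. k_smooth_on k U f)"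


section \<open>Riemannian geometry in a coordinate domain\<close>

text \<open>A metric on an open subset of \<open>real ^ 'k\<close> is given by its matrix field \<open>G\<close>, a vector field by
  its component function. Only values on the coordinate domain matter.\<close>

definition partial_deriv ::
  "'k::finite \<Rightarrow> (real ^ 'k \<Rightarrow> 'b::real_normed_vector) \<Rightarrow> real ^ 'k \<Rightarrow> 'b" where
  "partial_deriv i f u = frechet_derivative f (at u) (axis i 1)"

text \<open>\<open>christoffel G u l i j\<close> has upper index \<open>l\<close> and lower indices \<open>i\<close>, \<open>j\<close>.\<close>

definition christoffel ::
  "(real ^ 'k \<Rightarrow> real ^ 'k ^ 'k) \<Rightarrow> real ^ 'k \<Rightarrow> 'k::finite \<Rightarrow> 'k \<Rightarrow> 'k \<Rightarrow> real" where
  "christoffel G u l i j =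
     (\<Sum>m\<in>UNIV. matrix_inv (G u) $ l $ m *
        (partial_deriv i (\<lambda>w. G w $ m $ j) u + partial_deriv j (\<lambda>w. G w $ i $ m) u
          - partial_deriv m (\<lambda>w. G w $ i $ j) u)) / 2"

text \<open>The Levi-Civita connection of \<open>G\<close>: \<open>nabla G X Y\<close> is the covariant derivative of \<open>Y\<close>
  along \<open>X\<close>.\<close>

definition nabla ::
  "(real ^ 'k \<Rightarrow> real ^ 'k ^ 'k) \<Rightarrow> (real ^ 'k \<Rightarrow> real ^ 'k) \<Rightarrow> (real ^ 'k \<Rightarrow> real ^ 'k)
     \<Rightarrow> (real ^ 'k::finite \<Rightarrow> real ^ 'k)" where
  "nabla G X Y u =
     frechet_derivative Y (at u) (X u)
       + (\<chi> l. \<Sum>i\<in>UNIV. \<Sum>j\<in>UNIV. christoffel G u l i j * X u $ i * Y u $ j)"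

definition lie_bracket ::
  "(real ^ 'k \<Rightarrow> real ^ 'k) \<Rightarrow> (real ^ 'k \<Rightarrow> real ^ 'k) \<Rightarrow> (real ^ 'k::finite \<Rightarrow> real ^ 'k)" where
  "lie_bracket X Y u =
     frechet_derivative Y (at u) (X u) - frechet_derivative X (at u) (Y u)"

definition curvature ::
  "(real ^ 'k \<Rightarrow> real ^ 'k ^ 'k) \<Rightarrow> (real ^ 'k \<Rightarrow> real ^ 'k) \<Rightarrow> (real ^ 'k \<Rightarrow> real ^ 'k)
     \<Rightarrow> (real ^ 'k \<Rightarrow> real ^ 'k) \<Rightarrow> (real ^ 'k::finite \<Rightarrow> real ^ 'k)" where
  "curvature G X Y Z u =
     nabla G X (nabla G Y Z) u - nabla G Y (nabla G X Z) u - nabla G (lie_bracket X Y) Z u"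

definition jacobi_operator ::
  "(real ^ 'k \<Rightarrow> real ^ 'k ^ 'k) \<Rightarrow> (real ^ 'k \<Rightarrow> real ^ 'k) \<Rightarrow> (real ^ 'k \<Rightarrow> real ^ 'k)
     \<Rightarrow> (real ^ 'k::finite \<Rightarrow> real ^ 'k)" where
  "jacobi_operator G V Y = curvature G Y V V"

text \<open>\<open>nabla_endo G A X Y\<close> is the value on \<open>Y\<close> of the covariant derivative along \<open>X\<close> of the
  endomorphism field \<open>A\<close>, the latter acting on vector fields.\<close>

definition nabla_endo ::
  "(real ^ 'k \<Rightarrow> real ^ 'k ^ 'k)
     \<Rightarrow> ((real ^ 'k \<Rightarrow> real ^ 'k) \<Rightarrow> (real ^ 'k \<Rightarrow> real ^ 'k))
     \<Rightarrow> (real ^ 'k \<Rightarrow> real ^ 'k) \<Rightarrow> (real ^ 'k \<Rightarrow> real ^ 'k) \<Rightarrow> (real ^ 'k::finite \<Rightarrow> real ^ 'k)" where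
  "nabla_endo G A X Y u = nabla G X (A Y) u - A (nabla G X Y) u"


section \<open>Complex space forms\<close>

text \<open>Let \<open>n = CARD('n)\<close>. The vectors of complex \<open>(n + 1)\<close>-space are indexed by \<open>'n option\<close>, with
  \<open>None\<close> as zeroth index. The form \<open>herm c\<close> is the standard Hermitian form for \<open>c = 1\<close>, and has
  signature \<open>(n, 1)\<close> for \<open>c = -1\<close>.

  For \<open>c = 1\<close> or \<open>c = -1\<close>, the set \<open>herm c Z Z = c\<close> is the unit sphere or the anti-de Sitter
  space, and the space form is its quotient by the unit circle with the metric making the quotient
  map (the Hopf fibration) a pseudo-Riemannian submersion. This is complex projective or complex
  hyperbolic space with holomorphic sectional curvature \<open>4 c\<close>. A point is represented by its fibre,
  and the tangent space at \<open>fibre Z\<close> by the horizontal space at \<open>Z\<close>, on which \<open>Re (herm c V W)\<close> is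
  the (positive definite) metric and multiplication by the imaginary unit is the complex
  structure.\<close>

definition herm :: "real \<Rightarrow> complex ^ ('n::finite option) \<Rightarrow> complex ^ ('n option) \<Rightarrow> complex" where
  "herm c V W =
     of_real c * V $ None * cnj (W $ None) + (\<Sum>i\<in>UNIV. V $ Some i * cnj (W $ Some i))"

definition hyperquadric :: "real \<Rightarrow> (complex ^ ('n::finite option)) set" where
  "hyperquadric c = {Z. herm c Z Z = of_real c}"

definition fibre :: "complex ^ ('n::finite option) \<Rightarrow> (complex ^ ('n option)) set" where
  "fibre Z = {a *s Z |a. cmod a = 1}"

definition space_form :: "real \<Rightarrow> (complex ^ ('n::finite option)) set set" where
  "space_form c = fibre ` hyperquadric c"

definition horizontal_space ::
  "real \<Rightarrow> complex ^ ('n::finite option) \<Rightarrow> (complex ^ ('n option)) set" where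
  "horizontal_space c Z = {W. herm c W Z = 0}"

text \<open>The projection onto \<open>horizontal_space c Z\<close> along the complex line of \<open>Z\<close>, for \<open>Z\<close> in
  \<open>hyperquadric c\<close> and \<open>c = 1\<close> or \<open>c = -1\<close>.\<close>

definition horizontal ::
  "real \<Rightarrow> complex ^ ('n::finite option) \<Rightarrow> complex ^ ('n option) \<Rightarrow> complex ^ ('n option)" where
  "horizontal c Z W = W - (of_real c * herm c W Z) *s Z"


section \<open>Real hypersurfaces\<close>

text \<open>A smooth map into the space form is described locally by a smooth lift \<open>F\<close> to the
  hyperquadric. Its differential, in terms of horizontal vectors at \<open>F u\<close>, is the following.\<close>

definition differential ::
  "real \<Rightarrow> (real ^ 'k \<Rightarrow> complex ^ ('n option)) \<Rightarrow> real ^ 'k::finite \<Rightarrow> real ^ 'k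
     \<Rightarrow> complex ^ ('n::finite option)" where
  "differential c F u v = horizontal c (F u) (frechet_derivative F (at u) v)"

definition induced_metric ::
  "real \<Rightarrow> (real ^ 'k \<Rightarrow> complex ^ ('n::finite option)) \<Rightarrow> real ^ 'k::finite \<Rightarrow> real ^ 'k ^ 'k" where
  "induced_metric c F u =
     (\<chi> i j. Re (herm c (differential c F u (axis i 1)) (differential c F u (axis j 1))))"

text \<open>A local parametrization \<open>x\<close> of an open subset of \<open>M\<close> such that \<open>f \<circ> x\<close> is a smooth immersion
  with lift \<open>F\<close>. As \<open>f \<circ> x\<close> is locally an embedding, two such parametrizations have smooth
  transition maps, so they form the smooth atlas of \<open>M\<close>. Lifts always exist after shrinking
  \<open>U\<close>.\<close>

definition local_parametrization ::
  "real \<Rightarrow> 'a topology \<Rightarrow> ('a \<Rightarrow> (complex ^ ('n::finite option)) set)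
     \<Rightarrow> (real ^ 'k::finite) set \<Rightarrow> (real ^ 'k \<Rightarrow> 'a) \<Rightarrow> (real ^ 'k \<Rightarrow> complex ^ ('n option)) \<Rightarrow> bool"
  where
  "local_parametrization c M f U x F \<longleftrightarrow>
     open U \<and> openin M (x ` U) \<and> homeomorphic_map (top_of_set U) (subtopology M (x ` U)) x \<and>
     smooth_on U F \<and> F ` U \<subseteq> hyperquadric c \<and> (\<forall>u\<in>U. f (x u) = fibre (F u)) \<and>
     (\<forall>u\<in>U. inj (differential c F u))"

text \<open>A connected manifold \<open>M\<close> without boundary, of real dimension \<open>2 n - 1 = CARD('k)\<close>, immersed
  by \<open>f\<close> in the space form. Embedded hypersurfaces are the case of a subset \<open>M\<close> and its
  inclusion \<open>f\<close>.\<close>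

definition real_hypersurface ::
  "'k::finite itself \<Rightarrow> real \<Rightarrow> 'a topology \<Rightarrow> ('a \<Rightarrow> (complex ^ ('n::finite option)) set) \<Rightarrow> bool"
  where
  "real_hypersurface _ c M f \<longleftrightarrow>
     CARD('k) + 1 = 2 * CARD('n) \<and>
     topspace M \<noteq> {} \<and> connected_space M \<and> Hausdorff_space M \<and> second_countable M \<and>
     f ` topspace M \<subseteq> space_form c \<and>
     (\<forall>p\<in>topspace M. \<exists>U x (F :: real ^ 'k \<Rightarrow> complex ^ ('n option)).
        local_parametrization c M f U x F \<and> p \<in> x ` U)"

definition unit_normal_field ::
  "real \<Rightarrow> (real ^ 'k::finite) set \<Rightarrow> (real ^ 'k \<Rightarrow> complex ^ ('n::finite option))
     \<Rightarrow> (real ^ 'k \<Rightarrow> complex ^ ('n option)) \<Rightarrow> bool" where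
  "unit_normal_field c U F N \<longleftrightarrow>
     smooth_on U N \<and>
     (\<forall>u\<in>U. N u \<in> horizontal_space c (F u) \<and> Re (herm c (N u) (N u)) = 1 \<and>
        (\<forall>v. Re (herm c (N u) (differential c F u v)) = 0))"

text \<open>The tangent field \<open>- J N\<close>; it exists and is unique because the differential is injective,
  with image the orthogonal complement of \<open>N u\<close> in the horizontal space.\<close>

definition structure_field ::
  "real \<Rightarrow> (real ^ 'k \<Rightarrow> complex ^ ('n::finite option)) \<Rightarrow> (real ^ 'k \<Rightarrow> complex ^ ('n option))
     \<Rightarrow> real ^ 'k::finite \<Rightarrow> real ^ 'k" where
  "structure_field c F N u = (THE v. differential c F u v = - (\<i> *s N u))"

definition structure_jacobi_operator ::
  "real \<Rightarrow> (real ^ 'k \<Rightarrow> complex ^ ('n::finite option)) \<Rightarrow> (real ^ 'k \<Rightarrow> complex ^ ('n option))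
     \<Rightarrow> (real ^ 'k::finite \<Rightarrow> real ^ 'k) \<Rightarrow> (real ^ 'k \<Rightarrow> real ^ 'k)" where
  "structure_jacobi_operator c F N =
     jacobi_operator (induced_metric c F) (structure_field c F N)"

text \<open>The Codazzi equation is tensorial, so it is expressed with the smooth vector fields \<open>X\<close>, \<open>Y\<close>
  on the coordinate domains.\<close>

definition codazzi_structure_jacobi ::
  "'k::finite itself \<Rightarrow> real \<Rightarrow> 'a topology \<Rightarrow> ('a \<Rightarrow> (complex ^ ('n::finite option)) set) \<Rightarrow> bool"
  where
  "codazzi_structure_jacobi _ c M f \<longleftrightarrow>
     (\<forall>U x (F :: real ^ 'k \<Rightarrow> complex ^ ('n option)) N X Y.
        local_parametrization c M f U x F \<and> unit_normal_field c U F N \<and>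
        smooth_on U X \<and> smooth_on U Y \<longrightarrow>
        (\<forall>u\<in>U. nabla_endo (induced_metric c F) (structure_jacobi_operator c F N) X Y u
             = nabla_endo (induced_metric c F) (structure_jacobi_operator c F N) Y X u))"

end

theory Submission
  imports Defs
begin

text \<open>The statement is local, so a chart with a lift \<open>F\<close> and a unit normal \<open>N\<close> suffices. Let \<open>A\<close> be the
  shape operator, \<open>\<phi>\<close> the tangential part of the complex structure, \<open>W = A \<xi>\<close> and \<open>\<alpha> = g(W, \<xi>)\<close>.
  By the Gauss equation, \<open>R\<^sub>\<xi> Y = c (Y - g(Y, \<xi>) \<xi>) + \<alpha> A Y - g(Y, W) W\<close>. Differentiating this and
  using the Codazzi equation of the hypersurface, the hypothesis \<open>(\<nabla>\<^sub>X R\<^sub>\<xi>) Y = (\<nabla>\<^sub>Y R\<^sub>\<xi>) X\<close> becomes, at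
  every point, an algebraic relation between \<open>g\<close>, \<open>\<phi>\<close>, \<open>A\<close>, \<open>\<xi>\<close>, the endomorphism \<open>B X = \<nabla>\<^sub>X W\<close> and the
  differential of \<open>\<alpha>\<close>. It is the main axiom of the locale \<open>codazzi_data\<close>. Put \<open>T = W - \<alpha> \<xi>\<close>.

  If \<open>T = 0\<close> on the whole chart (the hypersurface is Hopf), then \<open>B\<close> is determined by \<open>d\<alpha>\<close> and \<open>A\<close>, and
  the relation says \<open>(c + \<alpha>\<^sup>2) \<phi>A + (\<xi>\<alpha>) A + \<alpha>c \<phi> = 0\<close> on the orthogonal complement of \<open>\<xi>\<close>. Hence \<open>A\<close> is
  there multiplication by a number \<open>k\<close> with \<open>k (c + \<alpha>\<^sup>2) = - \<alpha>c\<close>, whereas the \<open>\<xi>\<close>-component of the relation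
  requires \<open>\<alpha>k = - c\<close>, and these two equations exclude each other (\<open>orthogonal_vector_zero\<close>).

  If \<open>T \<noteq> 0\<close> at a point, consider the open set where \<open>T \<noteq> 0\<close>. On the complement \<open>D\<close> of \<open>\<xi>\<close>, \<open>T\<close> and
  \<open>\<phi> T\<close>, which is not zero because \<open>n > 2\<close>, the relation forces \<open>A = - \<alpha>\<close>, and then \<open>c = 1\<close> and
  \<open>\<alpha>\<^sup>2 = 1\<close> (\<open>c_alpha\<close>). So \<open>\<alpha>\<close> is locally constant. This ends the proof for \<open>c = -1\<close>. For \<open>c = 1\<close>,
  one more derivative is taken: with \<open>d\<alpha> = 0\<close>, the relation gives \<open>d |W|\<^sup>2 = - 2 (2 |W|\<^sup>2 - 1) \<zeta>\<close> for the one-form \<open>\<zeta> = g(\<phi> W, _)\<close> (\<open>B_W\<close>), with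
  \<open>2 |W|\<^sup>2 - 1 > 0\<close>, so that \<open>\<zeta>\<close> is closed. But \<open>d\<zeta>(\<xi>, T) = \<alpha> |T|\<^sup>2 (3 + |T|\<^sup>2)\<close>
  (\<open>d_phi_W_nonzero\<close>), which is not zero.

  The geometry is carried out in \<open>\<complex>\<^sup>n\<^sup>+\<^sup>1\<close>. A section along the immersion is a vector-valued function on
  the chart, and its covariant derivative \<open>cov\<close> is the derivative corrected by the vertical part \<open>\<tau>\<close> of
  \<open>dF\<close>. This connection is unitary for the Hermitian form, its curvature is multiplication by a scalar,
  and \<open>cov\<close> maps \<open>F\<close> itself to the horizontal differential \<open>L\<close> of the immersion. The Levi-Civita
  connection of the induced metric is its tangential part (\<open>nabla_eq\<close>), and the Codazzi equation and the
  part of the Gauss equation in the formula for \<open>R\<^sub>\<xi>\<close> both come from commuting two covariant derivatives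
  of \<open>N\<close> (\<open>cov_LA_diff\<close>), since \<open>\<xi>\<close> is \<open>- \<i> N\<close>.\<close>


section \<open>Calculus of smooth functions\<close>

text \<open>The recursion in \<open>k_smooth_on\<close> passes from \<open>f\<close> to its derivatives in fixed directions, as functions
  of the base point.\<close>

definition dir :: "'a::real_normed_vector \<Rightarrow> ('a \<Rightarrow> 'b::real_normed_vector) \<Rightarrow> 'a \<Rightarrow> 'b" where
  "dir v f u = frechet_derivative f (at u) v"

lemma dir_has_derivative: "(f has_derivative f') (at u) \<Longrightarrow> dir v f u = f' v"
  using frechet_derivative_at[of f f' u] by (simp add: dir_def)

lemma dir_cong:
  assumes "open U" "u \<in> U" "\<And>w. w \<in> U \<Longrightarrow> f w = g w"
  shows "frechet_derivative f (at u) = frechet_derivative g (at u)"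
proof -
  have "(f has_derivative h) (at u) \<longleftrightarrow> (g has_derivative h) (at u)" for h
    using has_derivative_transform_within_open[of f h u UNIV U g]
      has_derivative_transform_within_open[of g h u UNIV U f] assms by auto
  then show ?thesis
    by (simp add: frechet_derivative_def)
qed

lemma k_smooth_on_cong:
  assumes "open U" "\<And>u. u \<in> U \<Longrightarrow> f u = g u" "k_smooth_on k U f"
  shows "k_smooth_on k U g"
  using assms(2,3)
proof (induction k arbitrary: f g)
  case 0
  then show ?case by (simp cong: continuous_on_cong)
next
  case (Suc k)
  have "g differentiable_on U"
    unfolding differentiable_on_def
  proof
    fix u assume u: "u \<in> U"
    have "f differentiable at u within U"
      using Suc.prems(2) u by (simp add: differentiable_on_def)
    then show "g differentiable at u within U"
      by (rule differentiable_transform_within[OF _ zero_less_one u]) (simp add: Suc.prems(1))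
  qed
  moreover have "k_smooth_on k U (\<lambda>u. frechet_derivative g (at u) v)" for v
  proof (rule Suc.IH)
    show "frechet_derivative f (at u) v = frechet_derivative g (at u) v" if "u \<in> U" for u
      using dir_cong[OF assms(1) that Suc.prems(1)] by simp
    show "k_smooth_on k U (\<lambda>u. frechet_derivative f (at u) v)"
      using Suc.prems(2) by simp
  qed
  ultimately show ?case by simp
qed

lemma k_smooth_on_pred: "k_smooth_on (Suc k) U f \<Longrightarrow> k_smooth_on k U f"
  by (induction k arbitrary: f) (auto intro: differentiable_imp_continuous_on)

lemma k_smooth_on_subset: "k_smooth_on k U f \<Longrightarrow> V \<subseteq> U \<Longrightarrow> k_smooth_on k V f"
  by (induction k arbitrary: f) (auto intro: continuous_on_subset differentiable_on_subset)

lemma k_smooth_on_Suc_iff: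
  assumes "open U"
  shows "k_smooth_on (Suc k) U f \<longleftrightarrow>
    (\<forall>u\<in>U. (f has_derivative frechet_derivative f (at u)) (at u)) \<and> (\<forall>v. k_smooth_on k U (dir v f))"
proof -
  have "f differentiable_on U \<longleftrightarrow> (\<forall>u\<in>U. (f has_derivative frechet_derivative f (at u)) (at u))"
    unfolding frechet_derivative_works[symmetric] differentiable_on_def
    using at_within_open[OF _ assms] by auto
  then show ?thesis
    by (simp add: dir_def[abs_def])
qed

lemma k_smooth_on_SucI:
  assumes "open U" "\<And>u. u \<in> U \<Longrightarrow> (f has_derivative f' u) (at u)"
    "\<And>v. k_smooth_on k U (\<lambda>u. f' u v)"
  shows "k_smooth_on (Suc k) U f"
proof -
  have "f' u v = dir v f u" if "u \<in> U" for u v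
    using assms(2)[OF that] dir_has_derivative by metis
  then have "k_smooth_on k U (dir v f)" for v
    using k_smooth_on_cong[OF assms(1), of "\<lambda>u. f' u v" "dir v f"] assms(3) by auto
  then show ?thesis
    unfolding k_smooth_on_Suc_iff[OF assms(1)] frechet_derivative_works[symmetric]
    using assms(2) differentiableI by blast
qed

lemma k_smooth_on_const: "k_smooth_on k U (\<lambda>u. a)"
  by (induction k arbitrary: a) auto

lemma k_smooth_on_add:
  assumes "open U"
  shows "k_smooth_on k U f \<Longrightarrow> k_smooth_on k U g \<Longrightarrow> k_smooth_on k U (\<lambda>u. f u + g u)"
proof (induction k arbitrary: f g)
  case 0
  then show ?case by (auto intro: continuous_intros)
next
  case (Suc k)
  then show ?case
    unfolding k_smooth_on_Suc_iff[OF assms]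
    by (intro k_smooth_on_SucI[OF assms, unfolded k_smooth_on_Suc_iff[OF assms]])
      (auto intro!: derivative_eq_intros simp flip: dir_def)
qed

lemma (in bounded_linear) k_smooth_on:
  assumes "open U"
  shows "k_smooth_on k U g \<Longrightarrow> k_smooth_on k U (\<lambda>u. f (g u))"
proof (induction k arbitrary: g)
  case 0
  then show ?case by (auto intro: continuous_on)
next
  case (Suc k)
  then show ?case
    unfolding k_smooth_on_Suc_iff[OF assms]
    by (intro k_smooth_on_SucI[OF assms, unfolded k_smooth_on_Suc_iff[OF assms]])
      (auto intro!: has_derivative simp flip: dir_def)
qed

lemma (in bounded_bilinear) k_smooth_on:
  assumes "open U"
  shows "k_smooth_on k U f \<Longrightarrow> k_smooth_on k U g \<Longrightarrow> k_smooth_on k U (\<lambda>u. prod (f u) (g u))"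
proof (induction k arbitrary: f g)
  case 0
  then show ?case by (auto intro: continuous_on)
next
  case (Suc k)
  note fg = Suc.prems[THEN k_smooth_on_pred] Suc.prems[unfolded k_smooth_on_Suc_iff[OF assms]]
  show ?case
  proof (rule k_smooth_on_SucI[OF assms])
    show "((\<lambda>u. prod (f u) (g u)) has_derivative
        (\<lambda>h. prod (f u) (frechet_derivative g (at u) h) + prod (frechet_derivative f (at u) h) (g u))) (at u)"
      if "u \<in> U" for u
      using fg that by (intro FDERIV) auto
    show "k_smooth_on k U (\<lambda>u. prod (f u) (frechet_derivative g (at u) v) + prod (frechet_derivative f (at u) v) (g u))" for v
      using fg by (intro k_smooth_on_add[OF assms] Suc.IH) (auto simp: dir_def[abs_def])
  qed
qed

lemma k_smooth_on_inverse:
  fixes f :: "'a::real_normed_vector \<Rightarrow> real"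
  assumes "open U" "\<And>u. u \<in> U \<Longrightarrow> f u \<noteq> 0"
  shows "k_smooth_on k U f \<Longrightarrow> k_smooth_on k U (\<lambda>u. inverse (f u))"
proof (induction k)
  case 0
  then show ?case using assms by (auto intro!: continuous_intros)
next
  case (Suc k)
  note f = k_smooth_on_pred[OF Suc.prems] Suc.prems[unfolded k_smooth_on_Suc_iff[OF assms(1)]]
  show ?case
  proof (rule k_smooth_on_SucI[OF assms(1)])
    show "((\<lambda>u. inverse (f u)) has_derivative
        (\<lambda>h. - (inverse (f u) * frechet_derivative f (at u) h * inverse (f u)))) (at u)"
      if "u \<in> U" for u
      using f that assms(2) by (intro Deriv.has_derivative_inverse) auto
    show "k_smooth_on k U (\<lambda>u. - (inverse (f u) * frechet_derivative f (at u) v * inverse (f u)))" for v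
      using f Suc.IH
      by (intro bounded_linear.k_smooth_on[OF bounded_linear_minus[OF bounded_linear_ident] assms(1)]
           bounded_bilinear.k_smooth_on[OF bounded_bilinear_mult assms(1)]) (auto simp: dir_def[abs_def])
  qed
qed

lemma k_smooth_on_sqrt:
  fixes f :: "'a::real_normed_vector \<Rightarrow> real"
  assumes "open U" "\<And>u. u \<in> U \<Longrightarrow> f u > 0"
  shows "k_smooth_on k U f \<Longrightarrow> k_smooth_on k U (\<lambda>u. sqrt (f u))"
proof (induction k)
  case 0
  then show ?case by (auto intro!: continuous_intros)
next
  case (Suc k)
  note f = k_smooth_on_pred[OF Suc.prems] Suc.prems[unfolded k_smooth_on_Suc_iff[OF assms(1)]]
  have nz: "sqrt (f u) \<noteq> 0" if "u \<in> U" for u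
    using assms(2)[OF that] by simp
  show ?case
  proof (rule k_smooth_on_SucI[OF assms(1)])
    show "((\<lambda>u. sqrt (f u)) has_derivative
        (\<lambda>h. frechet_derivative f (at u) h * (inverse (sqrt (f u)) * (1/2)))) (at u)"
      if "u \<in> U" for u
    proof -
      have "(f has_derivative frechet_derivative f (at u)) (at u)" using f that by auto
      from has_derivative_real_sqrt[OF assms(2)[OF that] this]
      show ?thesis by (simp add: field_simps)
    qed
    show "k_smooth_on k U (\<lambda>u. frechet_derivative f (at u) v * (inverse (sqrt (f u)) * (1/2)))" for v
      using f Suc.IH nz
      by (intro bounded_bilinear.k_smooth_on[OF bounded_bilinear_mult assms(1)] k_smooth_on_const
          k_smooth_on_inverse assms(1)) (auto simp: dir_def[abs_def])
  qed
qed

lemma smooth_on_cong: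
  "open U \<Longrightarrow> (\<And>u. u \<in> U \<Longrightarrow> f u = g u) \<Longrightarrow> smooth_on U f \<Longrightarrow> smooth_on U g"
  unfolding smooth_on_def using k_smooth_on_cong by blast

lemma smooth_on_subset: "smooth_on U f \<Longrightarrow> V \<subseteq> U \<Longrightarrow> smooth_on V f"
  unfolding smooth_on_def using k_smooth_on_subset by blast

lemma smooth_on_const: "smooth_on U (\<lambda>u. a)"
  by (simp add: smooth_on_def k_smooth_on_const)

lemma smooth_on_add: "open U \<Longrightarrow> smooth_on U f \<Longrightarrow> smooth_on U g \<Longrightarrow> smooth_on U (\<lambda>u. f u + g u)"
  by (simp add: smooth_on_def k_smooth_on_add)

lemma (in bounded_linear) smooth_on: "open U \<Longrightarrow> smooth_on U g \<Longrightarrow> smooth_on U (\<lambda>u. f (g u))"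
  by (simp add: smooth_on_def k_smooth_on)

lemma (in bounded_bilinear) smooth_on:
  "open U \<Longrightarrow> smooth_on U f \<Longrightarrow> smooth_on U g \<Longrightarrow> smooth_on U (\<lambda>u. prod (f u) (g u))"
  by (simp add: smooth_on_def k_smooth_on)

lemmas smooth_on_mult = bounded_bilinear.smooth_on[OF bounded_bilinear_mult]
lemmas smooth_on_scaleR = bounded_bilinear.smooth_on[OF bounded_bilinear_scaleR]
lemmas smooth_on_minus = bounded_linear.smooth_on[OF bounded_linear_minus[OF bounded_linear_ident]]

lemma smooth_on_diff:
  "open U \<Longrightarrow> smooth_on U f \<Longrightarrow> smooth_on U g \<Longrightarrow> smooth_on U (\<lambda>u. f u - g u)"
  using smooth_on_add[of U f "\<lambda>u. - g u"] smooth_on_minus[of U g] by simp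

lemma smooth_on_inverse:
  fixes f :: "'a::real_normed_vector \<Rightarrow> real"
  shows "open U \<Longrightarrow> (\<And>u. u \<in> U \<Longrightarrow> f u \<noteq> 0) \<Longrightarrow> smooth_on U f \<Longrightarrow> smooth_on U (\<lambda>u. inverse (f u))"
  by (simp add: smooth_on_def k_smooth_on_inverse)

lemma smooth_on_divide:
  fixes f g :: "'a::real_normed_vector \<Rightarrow> real"
  shows "open U \<Longrightarrow> (\<And>u. u \<in> U \<Longrightarrow> g u \<noteq> 0) \<Longrightarrow> smooth_on U f \<Longrightarrow> smooth_on U g \<Longrightarrow> smooth_on U (\<lambda>u. f u / g u)"
  unfolding divide_inverse by (intro smooth_on_mult smooth_on_inverse)

lemma smooth_on_sqrt:
  fixes f :: "'a::real_normed_vector \<Rightarrow> real"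
  shows "open U \<Longrightarrow> (\<And>u. u \<in> U \<Longrightarrow> f u > 0) \<Longrightarrow> smooth_on U f \<Longrightarrow> smooth_on U (\<lambda>u. sqrt (f u))"
  by (simp add: smooth_on_def k_smooth_on_sqrt)

lemma smooth_on_sum:
  assumes "open U" "\<And>i. i \<in> I \<Longrightarrow> smooth_on U (f i)"
  shows "smooth_on U (\<lambda>u. \<Sum>i\<in>I. f i u)"
  using assms(2) by (induction I rule: infinite_finite_induct)
    (simp_all add: smooth_on_const smooth_on_add[OF assms(1)])

lemma smooth_on_prod:
  fixes f :: "'i \<Rightarrow> 'a::real_normed_vector \<Rightarrow> real"
  assumes "open U" "\<And>i. i \<in> I \<Longrightarrow> smooth_on U (f i)"
  shows "smooth_on U (\<lambda>u. \<Prod>i\<in>I. f i u)"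
  using assms(2) by (induction I rule: infinite_finite_induct)
    (simp_all add: smooth_on_const smooth_on_mult[OF assms(1)])

lemma smooth_on_vec:
  fixes f :: "'a::real_normed_vector \<Rightarrow> real ^ 'm::finite"
  assumes "open U" "\<And>i. smooth_on U (\<lambda>u. f u $ i)"
  shows "smooth_on U f"
proof -
  have "smooth_on U (\<lambda>u. \<Sum>i\<in>UNIV. f u $ i *\<^sub>R axis i (1::real))"
    using assms by (intro smooth_on_sum smooth_on_scaleR smooth_on_const)
  then show ?thesis
    by (rule smooth_on_cong[OF assms(1), rotated])
      (simp add: basis_expansion flip: scalar_mult_eq_scaleR)
qed

lemma smooth_on_vec_nth:
  "open U \<Longrightarrow> smooth_on U f \<Longrightarrow> smooth_on U (\<lambda>u. f u $ i)"
  by (rule bounded_linear.smooth_on[OF bounded_linear_vec_nth])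

lemma smooth_on_det:
  fixes M :: "'a::real_normed_vector \<Rightarrow> real ^ 'm ^ 'm::finite"
  assumes "open U" "\<And>i j. smooth_on U (\<lambda>u. M u $ i $ j)"
  shows "smooth_on U (\<lambda>u. det (M u))"
  unfolding det_def using assms
  by (intro smooth_on_sum smooth_on_mult smooth_on_prod smooth_on_const)

lemma matrix_inv_inverse:
  fixes M :: "real ^ 'm ^ 'm"
  assumes "invertible M"
  shows "M ** matrix_inv M = mat 1" "matrix_inv M ** M = mat 1"
  using someI_ex[OF assms[unfolded invertible_def]] by (simp_all add: matrix_inv_def)

text \<open>By Cramer's rule the solution is a rational function of the coefficients.\<close>

lemma smooth_on_linear_system:
  fixes M :: "'a::real_normed_vector \<Rightarrow> real ^ 'm ^ 'm::finite"
  assumes "open U" "\<And>i j. smooth_on U (\<lambda>u. M u $ i $ j)" "\<And>i. smooth_on U (\<lambda>u. y u $ i)"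
    and inv: "\<And>u. u \<in> U \<Longrightarrow> invertible (M u)"
  shows "smooth_on U (\<lambda>u. matrix_inv (M u) *v y u)"
proof (rule smooth_on_cong[OF assms(1)])
  fix u assume u: "u \<in> U"
  have "M u *v (matrix_inv (M u) *v y u) = y u"
    using matrix_inv_inverse(1)[OF inv[OF u]] by (simp add: matrix_vector_mul_assoc)
  then show "(\<chi> k. det(\<chi> i j. if j = k then y u $ i else M u $ i $ j) / det (M u)) = matrix_inv (M u) *v y u"
    using cramer[of "M u"] inv[OF u] by (simp add: invertible_det_nz)
next
  have "smooth_on U (\<lambda>u. if j = k then y u $ i else M u $ i $ j)" for i j k
    using assms by (cases "j = k") auto
  then show "smooth_on U (\<lambda>u. \<chi> k. det(\<chi> i j. if j = k then y u $ i else M u $ i $ j) / det (M u))"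
    using assms(1,2) inv[unfolded invertible_det_nz]
    by (intro smooth_on_vec) (auto intro!: smooth_on_divide smooth_on_det)
qed

lemma smooth_has_derivative:
  assumes "open U" "smooth_on U f" "u \<in> U"
  shows "(f has_derivative (\<lambda>v. dir v f u)) (at u)"
proof -
  have "k_smooth_on (Suc 0) U f" using assms by (simp add: smooth_on_def del: k_smooth_on.simps)
  then show ?thesis
    unfolding k_smooth_on_Suc_iff[OF assms(1)] using assms by (simp add: dir_def)
qed

lemma smooth_on_dir:
  assumes "smooth_on U f"
  shows "smooth_on U (dir v f)"
proof -
  have "k_smooth_on (Suc k) U f" for k using assms by (simp add: smooth_on_def del: k_smooth_on.simps)
  then show ?thesis
    by (simp add: smooth_on_def dir_def[abs_def])
qed

lemma smooth_on_continuous: "smooth_on U f \<Longrightarrow> continuous_on U f"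
  using k_smooth_on.simps(1) unfolding smooth_on_def by blast

lemma linear_dir:
  assumes "open U" "smooth_on U f" "u \<in> U"
  shows "linear (\<lambda>v. dir v f u)"
  using smooth_has_derivative[OF assms] has_derivative_linear by blast

lemma dir_transform:
  "open U \<Longrightarrow> u \<in> U \<Longrightarrow> (\<And>w. w \<in> U \<Longrightarrow> f w = g w) \<Longrightarrow> dir v f u = dir v g u"
  unfolding dir_def using dir_cong by metis

lemma dir_const: "dir v (\<lambda>u. a) u = 0"
  by (simp add: dir_def)

context
  fixes U :: "'a::real_normed_vector set" and u :: 'a
  assumes U: "open U" "u \<in> U"
begin

lemma dir_add: "smooth_on U f \<Longrightarrow> smooth_on U g \<Longrightarrow> dir v (\<lambda>u. f u + g u) u = dir v f u + dir v g u"
  by (rule dir_has_derivative) (intro has_derivative_add smooth_has_derivative[OF U(1) _ U(2)])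

lemma dir_diff: "smooth_on U f \<Longrightarrow> smooth_on U g \<Longrightarrow> dir v (\<lambda>u. f u - g u) u = dir v f u - dir v g u"
  by (rule dir_has_derivative) (intro has_derivative_diff smooth_has_derivative[OF U(1) _ U(2)])

lemma dir_minus: "smooth_on U f \<Longrightarrow> dir v (\<lambda>u. - f u) u = - dir v f u"
  by (rule dir_has_derivative) (intro has_derivative_minus smooth_has_derivative[OF U(1) _ U(2)])

lemma dir_sum:
  assumes "\<And>i. i \<in> I \<Longrightarrow> smooth_on U (f i)"
  shows "dir v (\<lambda>u. \<Sum>i\<in>I. f i u) u = (\<Sum>i\<in>I. dir v (f i) u)"
  by (rule dir_has_derivative[where f' = "\<lambda>v. \<Sum>i\<in>I. dir v (f i) u"])
    (intro has_derivative_sum smooth_has_derivative[OF U(1) _ U(2)] assms)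

end

lemma (in bounded_linear) dir:
  assumes "open U" "u \<in> U" "smooth_on U g"
  shows "dir v (\<lambda>u. f (g u)) u = f (dir v g u)"
  by (rule dir_has_derivative) (intro has_derivative smooth_has_derivative[OF assms(1,3,2)])

lemma (in bounded_bilinear) dir:
  assumes "open U" "u \<in> U" "smooth_on U f" "smooth_on U g"
  shows "dir v (\<lambda>u. prod (f u) (g u)) u = prod (f u) (dir v g u) + prod (dir v f u) (g u)"
  by (rule dir_has_derivative) (intro FDERIV smooth_has_derivative[OF assms(1,3,2)] smooth_has_derivative[OF assms(1,4,2)])

text \<open>The mean value theorem is applied in the direction \<open>x\<close> to the increments of \<open>f\<close> along \<open>y\<close>, and then in
  the direction \<open>y\<close>. The left-hand side is symmetric in \<open>x\<close> and \<open>y\<close>, and this is what makes the second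
  derivatives commute.\<close>

lemma second_difference:
  fixes f :: "'a::real_normed_vector \<Rightarrow> real"
  assumes "open U" "smooth_on U f" "t > 0"
    and sub: "\<And>p q. 0 \<le> p \<Longrightarrow> p \<le> t \<Longrightarrow> 0 \<le> q \<Longrightarrow> q \<le> t \<Longrightarrow> u + p *\<^sub>R x + q *\<^sub>R y \<in> U"
  obtains p q where "0 \<le> p" "p \<le> t" "0 \<le> q" "q \<le> t"
    "f (u + t *\<^sub>R x + t *\<^sub>R y) - f (u + t *\<^sub>R x) - f (u + t *\<^sub>R y) + f u
       = t * t * dir y (dir x f) (u + p *\<^sub>R x + q *\<^sub>R y)"
proof -
  have D: "((\<lambda>p. h (w + p *\<^sub>R x)) has_real_derivative dir x h (w + p *\<^sub>R x)) (at p)"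
    if "smooth_on U h" "w + p *\<^sub>R x \<in> U" for h :: "'a \<Rightarrow> real" and w x p
  proof -
    have "((\<lambda>p. w + p *\<^sub>R x) has_derivative (\<lambda>r. r *\<^sub>R x)) (at p)"
      by (auto intro!: derivative_eq_intros)
    from has_derivative_compose[OF this smooth_has_derivative[OF assms(1) that]]
    have "((\<lambda>p. h (w + p *\<^sub>R x)) has_derivative (\<lambda>r. dir (r *\<^sub>R x) h (w + p *\<^sub>R x))) (at p)" .
    moreover have "dir (r *\<^sub>R x) h (w + p *\<^sub>R x) = dir x h (w + p *\<^sub>R x) * r" for r
      using linear_scale[OF linear_dir[OF assms(1) that]] by simp
    ultimately show ?thesis
      by (simp add: has_field_derivative_def)
  qed
  \<comment> \<open>the increment along \<open>t y\<close> as a function of the position on the segment along \<open>x\<close>\<close>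
  define k where "k p = f ((u + t *\<^sub>R y) + p *\<^sub>R x) - f (u + p *\<^sub>R x)" for p
  have "\<exists>p. 0 < p \<and> p < t \<and> k t - k 0 = (t - 0) * (dir x f ((u + t *\<^sub>R y) + p *\<^sub>R x) - dir x f (u + p *\<^sub>R x))"
  proof (rule MVT2)
    fix p assume p: "0 \<le> p" "p \<le> t"
    have "u + t *\<^sub>R y + p *\<^sub>R x \<in> U" "u + p *\<^sub>R x \<in> U"
      using sub[OF p, of t] sub[OF p, of 0] assms(3) by (auto simp: algebra_simps)
    then show "(k has_real_derivative dir x f ((u + t *\<^sub>R y) + p *\<^sub>R x) - dir x f (u + p *\<^sub>R x)) (at p)"
      unfolding k_def by (intro DERIV_diff D assms(2))
  qed (fact assms(3))
  then obtain p where p: "0 < p" "p < t" "k t - k 0 = t * (dir x f ((u + p *\<^sub>R x) + t *\<^sub>R y) - dir x f ((u + p *\<^sub>R x) + 0 *\<^sub>R y))"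
    by (auto simp: algebra_simps)
  have "\<exists>q. 0 < q \<and> q < t \<and> dir x f ((u + p *\<^sub>R x) + t *\<^sub>R y) - dir x f ((u + p *\<^sub>R x) + 0 *\<^sub>R y)
      = (t - 0) * dir y (dir x f) ((u + p *\<^sub>R x) + q *\<^sub>R y)"
    using p(1,2) assms(3) sub[of p]
    by (intro MVT2 D smooth_on_dir assms(2)) auto
  then obtain q where q: "0 < q" "q < t" "dir x f ((u + p *\<^sub>R x) + t *\<^sub>R y) - dir x f ((u + p *\<^sub>R x) + 0 *\<^sub>R y)
      = t * dir y (dir x f) ((u + p *\<^sub>R x) + q *\<^sub>R y)"
    by auto
  show ?thesis
    using p q by (intro that[of p q]) (auto simp: k_def algebra_simps)
qed

lemma dir_commute_real:
  fixes f :: "'a::real_normed_vector \<Rightarrow> real"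
  assumes U: "open U" "u \<in> U" and f: "smooth_on U f"
  shows "dir y (dir x f) u = dir x (dir y f) u"
proof (rule ccontr)
  assume ne: "dir y (dir x f) u \<noteq> dir x (dir y f) u"
  define e where "e = \<bar>dir y (dir x f) u - dir x (dir y f) u\<bar> / 2"
  have e: "e > 0" using ne by (simp add: e_def)
  have "continuous (at u) (dir y (dir x f))" "continuous (at u) (dir x (dir y f))"
    using smooth_on_continuous[OF smooth_on_dir[OF smooth_on_dir[OF f]]] U
    by (auto simp: continuous_on_eq_continuous_at)
  note cont = this[THEN continuous_at_eps_delta[THEN iffD1], rule_format, OF e]
  obtain r1 where r1: "r1 > 0" "\<And>w. dist w u < r1 \<Longrightarrow> dist (dir y (dir x f) w) (dir y (dir x f) u) < e"
    using cont(1) by auto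
  obtain r2 where r2: "r2 > 0" "\<And>w. dist w u < r2 \<Longrightarrow> dist (dir x (dir y f) w) (dir x (dir y f) u) < e"
    using cont(2) by auto
  obtain r3 where r3: "r3 > 0" "ball u r3 \<subseteq> U"
    using U open_contains_ball by blast
  define r where "r = min r1 (min r2 r3)"
  have r: "r > 0" using r1 r2 r3 by (simp add: r_def)
  define t where "t = r / (2 * (norm x + norm y + 1))"
  have pos: "norm x + norm y + 1 > 0" by (smt (verit) norm_ge_zero)
  have t: "t > 0" using r pos by (simp add: t_def)
  have near: "dist (u + p *\<^sub>R x + q *\<^sub>R y) u < r" if "0 \<le> p" "p \<le> t" "0 \<le> q" "q \<le> t" for p q
  proof -
    have "norm (p *\<^sub>R x + q *\<^sub>R y) \<le> p * norm x + q * norm y"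
      using norm_triangle_ineq[of "p *\<^sub>R x" "q *\<^sub>R y"] that by simp
    also have "\<dots> \<le> t * norm x + t * norm y"
      using that by (intro add_mono mult_right_mono) auto
    also have "\<dots> \<le> t * (norm x + norm y + 1)"
      using t by (simp add: algebra_simps)
    also have "\<dots> = r / 2"
      using pos unfolding t_def by (simp only: times_divide_eq_left times_divide_eq_right) (simp add: field_simps)
    finally show ?thesis
      using r by (simp add: dist_norm add.assoc)
  qed
  have sub: "u + p *\<^sub>R x + q *\<^sub>R y \<in> U" if "0 \<le> p" "p \<le> t" "0 \<le> q" "q \<le> t" for p q
    using near[OF that] r3 by (auto simp: r_def dist_commute subset_iff)
  obtain p q where pq: "0 \<le> p" "p \<le> t" "0 \<le> q" "q \<le> t"
    "f (u + t *\<^sub>R x + t *\<^sub>R y) - f (u + t *\<^sub>R x) - f (u + t *\<^sub>R y) + f u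
       = t * t * dir y (dir x f) (u + p *\<^sub>R x + q *\<^sub>R y)"
    using second_difference[OF U(1) f t sub] by blast
  have sub': "u + p *\<^sub>R y + q *\<^sub>R x \<in> U" if "0 \<le> p" "p \<le> t" "0 \<le> q" "q \<le> t" for p q
    using sub[OF that(3,4,1,2)] by (simp add: add_ac)
  obtain p' q' where pq': "0 \<le> p'" "p' \<le> t" "0 \<le> q'" "q' \<le> t"
    "f (u + t *\<^sub>R y + t *\<^sub>R x) - f (u + t *\<^sub>R y) - f (u + t *\<^sub>R x) + f u
       = t * t * dir x (dir y f) (u + p' *\<^sub>R y + q' *\<^sub>R x)"
    using second_difference[OF U(1) f t sub'] by blast
  have "t * t * dir y (dir x f) (u + p *\<^sub>R x + q *\<^sub>R y) = t * t * dir x (dir y f) (u + p' *\<^sub>R y + q' *\<^sub>R x)"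
    using pq(5) pq'(5) by (simp add: algebra_simps)
  then have eq: "dir y (dir x f) (u + p *\<^sub>R x + q *\<^sub>R y) = dir x (dir y f) (u + q' *\<^sub>R x + p' *\<^sub>R y)"
    using t by (simp add: add_ac)
  have "dist (dir y (dir x f) (u + p *\<^sub>R x + q *\<^sub>R y)) (dir y (dir x f) u) < e"
    using near[OF pq(1-4)] by (intro r1) (simp add: r_def)
  moreover have "dist (dir x (dir y f) (u + q' *\<^sub>R x + p' *\<^sub>R y)) (dir x (dir y f) u) < e"
    using near[OF pq'(3,4,1,2)] by (intro r2) (simp add: r_def)
  ultimately show False
    using eq unfolding dist_real_def e_def by (auto simp: abs_if field_simps split: if_splits)
qed

lemma dir_commute:
  fixes f :: "'a::real_normed_vector \<Rightarrow> 'b::euclidean_space"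
  assumes U: "open U" "u \<in> U" and f: "smooth_on U f"
  shows "dir y (dir x f) u = dir x (dir y f) u"
proof (rule euclidean_eqI)
  fix b :: 'b
  have inner: "dir x (\<lambda>w. h w \<bullet> b) w = dir x h w \<bullet> b" if "smooth_on U h" "w \<in> U" for h x w
    using bounded_linear.dir[OF bounded_linear_inner_left U(1) that(2,1)] .
  have s: "smooth_on U (\<lambda>w. f w \<bullet> b)"
    by (rule bounded_linear.smooth_on[OF bounded_linear_inner_left U(1) f])
  have "dir y (dir x f) u \<bullet> b = dir y (dir x (\<lambda>w. f w \<bullet> b)) u" for x y
    using inner[OF smooth_on_dir[OF f] U(2)] dir_transform[OF U, of "dir x (\<lambda>w. f w \<bullet> b)"] inner[OF f]
    by metis
  then show "dir y (dir x f) u \<bullet> b = dir x (dir y f) u \<bullet> b"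
    using dir_commute_real[OF U s] by metis
qed


section \<open>The algebraic consequences of the Codazzi equation at a point\<close>

text \<open>The metric at a point is a bilinear form on the coordinate space, different from its standard inner
  product. It has to be a parameter, and identities of vectors are checked against all test vectors.\<close>

locale positive_form =
  fixes g :: "'v::real_vector \<Rightarrow> 'v \<Rightarrow> real"
  assumes linear_left: "linear (\<lambda>x. g x y)"
    and sym: "g x y = g y x"
    and pos: "x \<noteq> 0 \<Longrightarrow> g x x > 0"
begin

lemma linear_right: "linear (\<lambda>y. g x y)"
  using linear_left[of x] by (simp add: sym)

lemmas left_simps = linear_add[OF linear_left] linear_diff[OF linear_left]
  linear_neg[OF linear_left] linear_scale[OF linear_left] linear_0[OF linear_left]

lemmas right_simps = linear_add[OF linear_right] linear_diff[OF linear_right]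
  linear_neg[OF linear_right] linear_scale[OF linear_right] linear_0[OF linear_right]

lemmas form_simps = left_simps right_simps

lemma eq_0_iff: "g x x = 0 \<longleftrightarrow> x = 0"
  using pos[of x] by (cases "x = 0") (auto simp: form_simps)

lemma eq_iff: "x = y \<longleftrightarrow> (\<forall>z. g x z = g y z)"
proof
  assume "\<forall>z. g x z = g y z"
  then have "g (x - y) (x - y) = 0" by (simp add: form_simps)
  then show "x = y" by (simp add: eq_0_iff)
qed simp

end

text \<open>What remains at one point of a hypersurface whose structure Jacobi operator is of Codazzi type: the
  almost contact metric structure \<open>(\<phi>, \<xi>, g)\<close>, the shape operator \<open>A\<close>, the covariant derivative \<open>B\<close> of
  the field \<open>A \<xi>\<close>, and the differential \<open>d\<close> of \<open>g (A \<xi>) \<xi>\<close>. The assumption \<open>dW_eq\<close> is the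
  \<open>\<xi>\<close>-component of the Codazzi equation of the hypersurface. The assumption \<open>codazzi\<close> is the symmetry of
  \<open>\<nabla> R\<^sub>\<xi>\<close>, tested against \<open>z\<close> and freed from the derivatives of \<open>A\<close>.\<close>

locale codazzi_data = positive_form g for g :: "'v::real_vector \<Rightarrow> 'v \<Rightarrow> real" +
  fixes \<phi> A B :: "'v \<Rightarrow> 'v" and \<xi> :: 'v and c :: real and d :: "'v \<Rightarrow> real"
  assumes c: "c = 1 \<or> c = -1"
    and linear_maps: "linear \<phi>" "linear A" "linear B" "linear d"
    and xi_unit: "g \<xi> \<xi> = 1" and phi_xi: "\<phi> \<xi> = 0"
    and phi_phi: "\<phi> (\<phi> x) = - x + g x \<xi> *\<^sub>R \<xi>"
    and phi_skew: "g (\<phi> x) y = - g x (\<phi> y)"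
    and A_sym: "g (A x) y = g x (A y)"
    and d_eq: "d x = g (B x) \<xi> + g (A \<xi>) (\<phi> (A x))"
    and dW_eq: "g (B x) y - g (B y) x = 2 * g (A (\<phi> (A x))) y - 2 * c * g (\<phi> x) y"
    and codazzi: "- c * (g (\<phi> (A x)) y + g (A (\<phi> x)) y) * g \<xi> z
      - c * (g y \<xi> * g (\<phi> (A x)) z - g x \<xi> * g (\<phi> (A y)) z)
      + d x * g (A y) z - d y * g (A x) z
      + g (A \<xi>) \<xi> * c * (g x \<xi> * g (\<phi> y) z - g y \<xi> * g (\<phi> x) z - 2 * g (\<phi> x) y * g \<xi> z)
      - (2 * g (A (\<phi> (A x))) y - 2 * c * g (\<phi> x) y) * g (A \<xi>) z
      - g y (A \<xi>) * g (B x) z + g x (A \<xi>) * g (B y) z = 0"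
begin

definition W where "W = A \<xi>"
definition \<alpha> where "\<alpha> = g W \<xi>"
definition T where "T = W - \<alpha> *\<^sub>R \<xi>"
definition V where "V = \<phi> W"
definition b where "b = g T T"

lemmas map_simps = linear_add[OF linear_maps(1)] linear_diff[OF linear_maps(1)]
  linear_neg[OF linear_maps(1)] linear_scale[OF linear_maps(1)] linear_0[OF linear_maps(1)]
  linear_add[OF linear_maps(2)] linear_diff[OF linear_maps(2)]
  linear_neg[OF linear_maps(2)] linear_scale[OF linear_maps(2)] linear_0[OF linear_maps(2)]
  linear_add[OF linear_maps(3)] linear_diff[OF linear_maps(3)]
  linear_neg[OF linear_maps(3)] linear_scale[OF linear_maps(3)] linear_0[OF linear_maps(3)]
  linear_add[OF linear_maps(4)] linear_diff[OF linear_maps(4)]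
  linear_neg[OF linear_maps(4)] linear_scale[OF linear_maps(4)] linear_0[OF linear_maps(4)]

lemma c_nz: "c \<noteq> 0"
  using c by auto

lemma W_eq: "W = T + \<alpha> *\<^sub>R \<xi>"
  by (simp add: T_def)

lemma phi_T: "\<phi> T = V"
  by (simp add: T_def V_def map_simps phi_xi)

lemma phi_phi_form: "g (\<phi> x) (\<phi> y) = g x y - g x \<xi> * g y \<xi>"
  using phi_skew[of x "\<phi> y"] sym[of x \<xi>] by (simp add: phi_phi form_simps)

lemma g_phi_self: "g (\<phi> x) x = 0"
  using phi_skew[of x x] sym[of x "\<phi> x"] by simp

lemma g_phi_xi: "g (\<phi> x) \<xi> = 0" "g \<xi> (\<phi> x) = 0"
  by (simp_all add: phi_skew phi_xi form_simps sym[of \<xi>])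

lemma T_xi: "g T \<xi> = 0" "g \<xi> T = 0"
proof -
  show "g T \<xi> = 0" by (simp add: T_def \<alpha>_def form_simps xi_unit)
  then show "g \<xi> T = 0" by (simp only: sym[of \<xi> T])
qed

lemma W_T: "g W T = b" "g T W = b"
  by (simp_all add: W_eq b_def form_simps T_xi)

lemma W_xi: "g W \<xi> = \<alpha>" "g \<xi> W = \<alpha>"
  by (simp_all add: \<alpha>_def sym)

lemma W_W: "g W W = \<alpha> * \<alpha> + b"
  by (simp add: W_eq b_def form_simps T_xi xi_unit)

lemma V_xi: "g V \<xi> = 0" "g \<xi> V = 0"
  by (simp_all add: V_def g_phi_xi)

lemma V_W: "g V W = 0" "g W V = 0"
  by (simp_all add: V_def g_phi_self sym[of W])

lemma V_T: "g V T = 0" "g T V = 0"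
  by (simp_all add: T_def form_simps V_xi V_W)

lemma V_V: "g V V = b"
  by (simp add: V_def phi_phi_form W_W W_xi)

lemma phi_V: "\<phi> V = - T"
  by (simp add: V_def phi_phi T_def W_xi)

lemmas frame_simps = T_xi W_T W_xi W_W V_xi V_W V_T V_V phi_V phi_T b_def[symmetric]
  xi_unit phi_xi g_phi_xi V_def[symmetric] W_def[symmetric]

lemma b_nonneg: "b \<ge> 0" 
  unfolding b_def using pos[of T] by (cases "T = 0") (auto simp: form_simps)

lemma b_0_iff: "b = 0 \<longleftrightarrow> T = 0"
  by (simp add: b_def eq_0_iff)

text \<open>The \<open>\<xi>\<close>-component, which expresses that \<open>R\<^sub>\<xi> \<phi> A\<close> is self-adjoint. The derivative \<open>B\<close> drops out because
  \<open>d_eq\<close> computes its \<open>\<xi>\<close>-component.\<close>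

lemma codazzi_xi:
  "c * (g (\<phi> (A x)) y + g (A (\<phi> x)) y) + 2 * \<alpha> * g (A (\<phi> (A x))) y
     = g W y * g W (\<phi> (A x)) - g W x * g W (\<phi> (A y))"
proof -
  have B: "g (B x) \<xi> = d x - g W (\<phi> (A x))" for x
    using d_eq[of x] by (simp add: W_def)
  show ?thesis
    using codazzi[of x y \<xi>]
    by (simp add: frame_simps B A_sym sym[of y W] sym[of x W] sym[of y \<xi>] sym[of x \<xi>])
      (simp add: algebra_simps)
qed

text \<open>Self-adjointness of \<open>R\<^sub>\<xi> \<phi> A\<close>, applied to \<open>\<xi>\<close>: as \<open>R\<^sub>\<xi> \<xi> = 0\<close>, it gives \<open>R\<^sub>\<xi> \<phi> W = 0\<close>. Where \<open>V\<close> is not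
  zero, this makes \<open>V\<close> an eigenvector of \<open>A\<close> and excludes \<open>\<alpha> = 0\<close>.\<close>

lemma A_V: "c *\<^sub>R V + \<alpha> *\<^sub>R A V = 0"
proof -
  have "c * g V y + \<alpha> * g (A V) y = 0" for y
  proof -
    have "g W (\<phi> (A y)) = - g (A V) y"
      using phi_skew[of W "A y"] by (simp add: A_sym frame_simps)
    then show ?thesis
      using codazzi_xi[of \<xi> y] by (simp add: frame_simps map_simps form_simps)
  qed
  then show ?thesis
    by (subst eq_iff) (simp add: form_simps)
qed

end

section \<open>Points where the structure field is not principal\<close>

locale non_Hopf_data = codazzi_data +
  assumes T_nz: "T \<noteq> 0"
begin

definition D :: "'a set" where "D = {x. g x \<xi> = 0 \<and> g x T = 0 \<and> g x V = 0}"

lemma D_simps: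
  assumes "x \<in> D"
  shows "g x \<xi> = 0" "g \<xi> x = 0" "g x T = 0" "g T x = 0" "g x V = 0" "g V x = 0" "g x W = 0" "g W x = 0"
proof -
  show 1: "g x \<xi> = 0" "g x T = 0" "g x V = 0"
    using assms by (simp_all add: D_def)
  then show 2: "g \<xi> x = 0" "g T x = 0" "g V x = 0"
    by (simp_all only: sym[of _ x])
  show "g x W = 0" "g W x = 0"
    using 1 2 by (simp_all add: W_eq form_simps)
qed

lemma D_phi:
  assumes "x \<in> D" shows "\<phi> x \<in> D"
  using D_simps[OF assms] by (simp add: D_def phi_skew frame_simps form_simps)

lemma b_pos: "b > 0"
  using b_nonneg b_0_iff T_nz by linarith

lemma V_nz: "V \<noteq> 0"
  using V_V b_pos by (auto simp: form_simps)

lemma alpha_nz: "\<alpha> \<noteq> 0"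
  using A_V V_nz c_nz by auto

lemma A_V': "A V = (- (c / \<alpha>)) *\<^sub>R V"
proof -
  have "\<alpha> *\<^sub>R A V = \<alpha> *\<^sub>R ((- (c / \<alpha>)) *\<^sub>R V)"
    using A_V alpha_nz by (simp add: add_eq_0_iff2)
  then show ?thesis
    using real_vector.scale_left_imp_eq[OF alpha_nz] by blast
qed

lemma g_AV: "g (A V) x = - (c / \<alpha>) * g V x" "g x (A V) = - (c / \<alpha>) * g V x" 
   "g (A x) V = - (c / \<alpha>) * g V x" "g V (A x) = - (c / \<alpha>) * g V x"
  by (simp_all add: A_V' form_simps A_sym[of x V] A_sym[of V, symmetric] sym[of x V])

text \<open>For \<open>x\<close> and \<open>y\<close> orthogonal to both \<open>\<xi>\<close> and \<open>W\<close>, the terms with \<open>B\<close> vanish, and \<open>codazzi_xi\<close> turns the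
  coefficient of \<open>\<xi>\<close> into \<open>- \<alpha>\<close> times that of \<open>W\<close>. Only a multiple of \<open>T\<close> remains on the right.\<close>

lemma codazzi_holomorphic:
  assumes x: "g x \<xi> = 0" "g x T = 0" and y: "g y \<xi> = 0" "g y T = 0"
  shows "d x * g (A y) z - d y * g (A x) z = 2 * (g (A (\<phi> (A x))) y - c * g (\<phi> x) y) * g T z"
proof -
  have W: "g x W = 0" "g y W = 0" "g W x = 0" "g W y = 0"
    using x y by (simp_all add: W_eq form_simps sym)
  have "c * (g (\<phi> (A x)) y + g (A (\<phi> x)) y) + 2 * \<alpha> * g (A (\<phi> (A x))) y = 0"
    using codazzi_xi[of x y] by (simp add: W)
  then have *: "c * (g (\<phi> (A x)) y + g (A (\<phi> x)) y) = - 2 * \<alpha> * g (A (\<phi> (A x))) y"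
    by linarith
  have Tz: "g T z = g W z - \<alpha> * g \<xi> z"
    by (simp add: T_def form_simps)
  have "d x * g (A y) z - d y * g (A x) z
     = c * (g (\<phi> (A x)) y + g (A (\<phi> x)) y) * g \<xi> z + \<alpha> * c * 2 * g (\<phi> x) y * g \<xi> z
      + (2 * g (A (\<phi> (A x))) y - 2 * c * g (\<phi> x) y) * g W z"
    using codazzi[of x y z] by (simp add: W x y frame_simps)
  then show ?thesis
    unfolding * Tz by (simp add: algebra_simps)
qed

lemma d_D:
  assumes "x \<in> D" shows "d x = 0"
proof -
  have "d x * (c / \<alpha>) * b = 0"
    using codazzi_holomorphic[of x V V] assms by (simp add: D_simps frame_simps g_AV)
  then show ?thesis
    using alpha_nz c_nz b_pos by simp
qed

lemma A_phi_A_D: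
  assumes "x \<in> D" "y \<in> D" shows "g (A (\<phi> (A x))) y = c * g (\<phi> x) y"
  using codazzi_holomorphic[of x y T] assms b_pos by (simp add: D_simps frame_simps d_D)

text \<open>Here \<open>codazzi_holomorphic\<close> is used with \<open>y = V\<close>, an eigenvector of \<open>A\<close> with eigenvalue \<open>- c / \<alpha>\<close>, to
  which \<open>x\<close> and \<open>\<phi> x\<close> are orthogonal.\<close>

lemma d_V_D:
  assumes "x \<in> D"
  shows "d V * g (A x) z = 2 * (c / \<alpha>) * g (A x) T * g T z"
proof -
  have 1: "g (A (\<phi> (A x))) V = - (c / \<alpha>) * g (A x) T"
    by (simp add: g_AV) (simp add: sym[of V] phi_skew frame_simps form_simps)
  show ?thesis
    using codazzi_holomorphic[of x V z] assms
    by (simp add: D_simps frame_simps d_D 1 phi_skew[of x V] form_simps)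
qed

text \<open>Otherwise \<open>A\<close> would map \<open>D\<close> into the line of \<open>T\<close>, so that \<open>A \<phi> A\<close> would vanish on \<open>D\<close> as a bilinear
  form, in contradiction to \<open>A_phi_A_D\<close>.\<close>

lemma d_V:
  assumes "x \<in> D" "x \<noteq> 0"
  shows "d V = 0"
proof (rule ccontr)
  assume nz: "d V \<noteq> 0"
  have px: "\<phi> x \<in> D" using assms D_phi by blast
  obtain \<kappa> where k: "A (\<phi> x) = \<kappa> *\<^sub>R T"
  proof
    show "A (\<phi> x) = (2 * (c / \<alpha>) * g (A (\<phi> x)) T / d V) *\<^sub>R T"
      using d_V_D[OF px] nz by (subst eq_iff) (simp add: form_simps eq_divide_eq mult_ac alpha_nz)
  qed
  have "g (A (\<phi> (A x))) (\<phi> x) = g (\<phi> (A x)) (A (\<phi> x))"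
    by (simp add: A_sym)
  also have "\<dots> = 0"
    using assms(1) by (simp add: k form_simps phi_skew frame_simps g_AV D_simps)
  finally have "g (\<phi> x) (\<phi> x) = 0"
    using A_phi_A_D[OF assms(1) px] c_nz by simp
  then show False
    using assms by (simp add: phi_phi_form D_simps eq_0_iff)
qed

lemma A_D:
  assumes "x \<in> D"
  shows "A x \<in> D"
proof (cases "x = 0")
  case True
  then show ?thesis by (simp add: D_def map_simps form_simps)
next
  case False
  then have "g (A x) T = 0"
    using d_V_D[OF assms, of T] d_V[OF assms False] alpha_nz c_nz b_pos by (simp add: frame_simps)
  moreover have "g (A x) \<xi> = 0"
    using assms by (simp add: A_sym frame_simps D_simps)
  moreover have "g (A x) V = 0"
    using D_simps[OF assms] by (simp add: g_AV)
  ultimately show ?thesis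
    by (simp add: D_def)
qed

lemma anticommute_D:
  assumes "x \<in> D" "y \<in> D"
  shows "g (\<phi> (A x)) y + g (A (\<phi> x)) y = - 2 * \<alpha> * g (\<phi> x) y"
proof -
  have "c * (g (\<phi> (A x)) y + g (A (\<phi> x)) y) = c * (- 2 * \<alpha> * g (\<phi> x) y)"
    using codazzi_xi[of x y] assms by (simp add: D_simps A_phi_A_D) (simp add: algebra_simps)
  then show ?thesis using c_nz by (simp only: mult_cancel_left) simp
qed

text \<open>The coefficient that results when \<open>B\<close> is eliminated between the relations for \<open>y = \<xi>\<close> and \<open>y = T\<close>.\<close>

definition p where "p = \<alpha> * d T - b * d \<xi>"

lemma p_D:
  assumes "x \<in> D" "z \<in> D"
  shows "p * g (A x) z = b * c * (g (\<phi> (A x)) z + \<alpha> * g (\<phi> x) z)"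
proof -
  have Ax: "A x \<in> D" "\<phi> x \<in> D" "\<phi> (A x) \<in> D" "A (\<phi> (A x)) \<in> D" "A (\<phi> x) \<in> D"
    using A_D D_phi assms by simp_all
  have 1: "- c * g (\<phi> (A x)) z - d \<xi> * g (A x) z - \<alpha> * c * g (\<phi> x) z - \<alpha> * g (B x) z = 0"
    using codazzi[of x \<xi> z] assms by (simp add: D_simps Ax d_D frame_simps)
  have 2: "- d T * g (A x) z - b * g (B x) z = 0"
    using codazzi[of x T z] assms by (simp add: D_simps Ax d_D frame_simps)
  have "p * g (A x) z = \<alpha> * (d T * g (A x) z) - b * (d \<xi> * g (A x) z)"
    by (simp add: p_def algebra_simps)
  also have "\<dots> = \<alpha> * (- b * g (B x) z) - b * (- c * g (\<phi> (A x)) z - \<alpha> * c * g (\<phi> x) z - \<alpha> * g (B x) z)"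
  proof -
    have "d T * g (A x) z = - b * g (B x) z"
      "d \<xi> * g (A x) z = - c * g (\<phi> (A x)) z - \<alpha> * c * g (\<phi> x) z - \<alpha> * g (B x) z"
      using 1 2 by simp_all
    then show ?thesis by simp
  qed
  finally show ?thesis by (simp add: algebra_simps)
qed

text \<open>By \<open>p_D\<close>, the numbers \<open>p * g (A x) x\<close> and \<open>p * g (A (\<phi> x)) (\<phi> x)\<close> are opposite, whereas by
  \<open>anticommute_D\<close> the sum of \<open>g (A x) x\<close> and \<open>g (A (\<phi> x)) (\<phi> x)\<close> is \<open>- 2 * \<alpha> * g x x\<close>.\<close>

lemma p_0:
  assumes "x \<in> D" "x \<noteq> 0"
  shows "p = 0"
proof -
  have px: "\<phi> x \<in> D" using assms D_phi by blast
  have m: "g (\<phi> x) (\<phi> x) = g x x" "g x x > 0"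
    using assms pos by (simp_all add: phi_phi_form D_simps)
  have "p * g (A x) x = - (b * c * g (A x) (\<phi> x))"
    using p_D[OF assms(1,1)] by (simp add: g_phi_self phi_skew[of "A x" x])
  moreover have "p * g (A (\<phi> x)) (\<phi> x) = b * c * g (A x) (\<phi> x)"
    using p_D[OF px px] assms
    by (simp add: phi_phi_form A_D px D_simps A_sym[of "\<phi> x" x] sym[of "\<phi> x" "A x"] g_phi_self[of x])
  moreover have "g (A x) x + g (A (\<phi> x)) (\<phi> x) = - 2 * \<alpha> * g x x"
    using anticommute_D[OF assms(1) px] assms by (simp add: phi_phi_form D_simps)
  ultimately have "p * (- 2 * \<alpha> * g x x) = 0"
    by (metis add.left_inverse distrib_left)
  then show ?thesis
    using m alpha_nz by simp
qed

lemma A_eq_on_D: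
  assumes "x \<in> D"
  shows "A x = - \<alpha> *\<^sub>R x"
proof (cases "x = 0")
  case True
  then show ?thesis by (simp add: map_simps)
next
  case False
  let ?y = "A x + \<alpha> *\<^sub>R x"
  have y: "?y \<in> D"
    using A_D[OF assms] assms by (simp add: D_def form_simps)
  have "b * c * (g (\<phi> (A x)) (\<phi> ?y) + \<alpha> * g (\<phi> x) (\<phi> ?y)) = 0"
    using p_D[OF assms D_phi[OF y]] p_0[OF assms False] by simp
  then have "b * c * g (\<phi> ?y) (\<phi> ?y) = 0"
    by (simp add: left_simps map_simps)
  then have "g ?y ?y = 0"
    using b_pos c_nz y by (simp add: phi_phi_form D_simps)
  then show ?thesis
    by (simp add: eq_0_iff add_eq_0_iff2)
qed

text \<open>Substituting \<open>A = - \<alpha>\<close> into \<open>A_phi_A_D\<close> gives \<open>\<alpha>\<^sup>2 = c\<close>. The vector \<open>x\<close> is needed because \<open>D\<close> may be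
  zero in low dimension.\<close>

lemma c_alpha:
  assumes "x \<in> D" "x \<noteq> 0"
  shows "c = 1" "\<alpha> * \<alpha> = 1"
proof -
  have px: "\<phi> x \<in> D" using assms D_phi by blast
  have "\<alpha> * \<alpha> * g x x = c * g x x"
    using A_phi_A_D[OF assms(1) px] assms(1)
    by (simp add: A_eq_on_D px map_simps form_simps phi_phi_form D_simps)
  then have "\<alpha> * \<alpha> = c"
    using pos[OF assms(2)] by simp
  moreover then have "c \<ge> 0"
    by (metis zero_le_square)
  ultimately show "c = 1" "\<alpha> * \<alpha> = 1"
    using c by auto
qed


lemma decompose:
  obtains z r s t where "z \<in> D" "x = z + r *\<^sub>R \<xi> + s *\<^sub>R T + t *\<^sub>R V"
proof
  let ?z = "x - g x \<xi> *\<^sub>R \<xi> - (g x T / b) *\<^sub>R T - (g x V / b) *\<^sub>R V"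
  show "?z \<in> D"
    using b_pos by (simp add: D_def form_simps frame_simps)
  show "x = ?z + g x \<xi> *\<^sub>R \<xi> + (g x T / b) *\<^sub>R T + (g x V / b) *\<^sub>R V"
    by simp
qed

end

text \<open>The conclusions of \<open>c_alpha\<close> hold on an open set, where they imply \<open>d = 0\<close>. The products of \<open>B x\<close>
  with \<open>W\<close> are then functions of \<open>\<alpha>\<close> and \<open>b\<close> in the frame \<open>\<xi>\<close>, \<open>T\<close>, \<open>V\<close>.\<close>

locale non_Hopf_constant_data = non_Hopf_data +
  assumes c_1: "c = 1" and alpha_sq: "\<alpha> * \<alpha> = 1" and d_0: "d x = 0"
    and A_D_eq: "x \<in> D \<Longrightarrow> A x = - \<alpha> *\<^sub>R x"
begin

lemma alpha_inverse: "1 / \<alpha> = \<alpha>"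
  using alpha_sq alpha_nz by (simp add: field_simps)

lemma A_V_eq: "A V = - \<alpha> *\<^sub>R V"
  using A_V' by (simp add: c_1 alpha_inverse)

lemma g_A_V: "g (A V) x = - \<alpha> * g V x" "g x (A V) = - \<alpha> * g V x" 
   "g (A x) V = - \<alpha> * g V x" "g V (A x) = - \<alpha> * g V x"
  using g_AV[of x] by (simp_all add: c_1 alpha_inverse)

lemma B_xi: "g (B x) \<xi> = - \<alpha> * g V x"
  using d_eq[of x] phi_skew[of W "A x"] by (simp add: d_0 frame_simps g_A_V)

lemma codazzi': "- (g (\<phi> (A x)) y + g (A (\<phi> x)) y) * g \<xi> z
      - (g y \<xi> * g (\<phi> (A x)) z - g x \<xi> * g (\<phi> (A y)) z)
      + \<alpha> * (g x \<xi> * g (\<phi> y) z - g y \<xi> * g (\<phi> x) z - 2 * g (\<phi> x) y * g \<xi> z)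
      - (2 * g (A (\<phi> (A x))) y - 2 * g (\<phi> x) y) * g W z
      - g y W * g (B x) z + g x W * g (B y) z = 0"
  using codazzi[of x y z] by (simp add: d_0 c_1 frame_simps)

lemma B_D: 
  assumes "x \<in> D"
  shows "g (B x) W = 0"
  using codazzi'[of x T W] assms b_pos
  by (simp add: A_D_eq map_simps form_simps D_simps frame_simps phi_skew[of x] A_sym[of "\<phi> x"]
     D_phi)

lemma B_xi_T: "g (B \<xi>) T = 0"
  using dW_eq[of \<xi> T] by (simp add: frame_simps B_xi g_A_V map_simps form_simps)

lemma B_xi_W: "g (B \<xi>) W = 0"
  by (simp add: W_eq form_simps B_xi B_xi_T frame_simps)

lemma B_T_W: "g (B T) W = 0"
proof -
  have "\<alpha> * g (B T) T = 0"
    using codazzi'[of \<xi> T T] 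
    by (simp add: frame_simps B_xi_T g_A_V map_simps form_simps phi_skew[of "A T"])
  then show ?thesis
    using alpha_nz by (simp add: W_eq form_simps B_xi frame_simps)
qed

lemma B_V_W: "g (B V) W = - (1 + 2 * b) * b"
proof -
  have "\<alpha> * (g (B V) W + (1 + 2 * b) * b) = 0"
    using codazzi'[of \<xi> V W] alpha_sq
    by (simp add: frame_simps A_V_eq map_simps form_simps distrib_left mult_ac)
  then have "g (B V) W + (1 + 2 * b) * b = 0"
    using alpha_nz by simp
  then show ?thesis
    by (simp add: algebra_simps)
qed

text \<open>The left-hand side is half the derivative of \<open>g W W\<close> along \<open>x\<close>. By this formula, that derivative is a
  function of \<open>g W W\<close> times the one-form \<open>g V\<close>.\<close>

lemma B_W: "g (B x) W = - (1 + 2 * b) * g V x"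
proof -
  obtain z r s t where z: "z \<in> D" and x: "x = z + r *\<^sub>R \<xi> + s *\<^sub>R T + t *\<^sub>R V"
    using decompose by blast
  show ?thesis
    unfolding x using z
    by (simp add: map_simps form_simps B_D B_xi_W B_T_W B_V_W D_simps frame_simps)
qed

lemma A_T_T: "g (A T) T = \<alpha> * b * (b - 1)"
proof -
  have "\<alpha> * (\<alpha> * g (A T) T) = g (A T) T" 
    using alpha_sq by (metis mult.assoc mult_1)
  moreover have "\<alpha> * b + 2 * (\<alpha> * (\<alpha> * g (A T) T)) = g (A T) T + \<alpha> * (b * b)"
    using codazzi_xi[of V T] 
    by (simp add: c_1 A_V_eq map_simps form_simps frame_simps) (simp add: algebra_simps)
  ultimately show ?thesis
    unfolding right_diff_distrib mult.assoc mult_1_right by linarith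
qed

text \<open>The value on \<open>(\<xi>, T)\<close> of the exterior derivative of the one-form \<open>g (\<phi> W)\<close>; see \<open>dir_zeta\<close>.\<close>

lemma d_phi_W_nonzero:
  "g (\<phi> (B \<xi>)) T - g (\<phi> (B T)) \<xi> + g W (A T) \<noteq> 0"
proof -
  have 1: "g (\<phi> (B \<xi>)) T = 3 * \<alpha> * b"
    using dW_eq[of \<xi> V] by (simp add: phi_skew[of "B \<xi>"] frame_simps B_xi g_A_V map_simps form_simps)
  have 2: "g W (A T) = \<alpha> * b * b"
    using A_T_T A_sym[of \<xi> T] 
    by (simp add: W_eq form_simps frame_simps sym[of T "A T"]) (simp add: algebra_simps)
  have "g (\<phi> (B \<xi>)) T - g (\<phi> (B T)) \<xi> + g W (A T) = \<alpha> * b * (3 + b)"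
    by (simp add: 1 2 frame_simps algebra_simps)
  then show ?thesis
    using alpha_nz b_pos by simp
qed

end

section \<open>Hopf hypersurfaces\<close>

text \<open>When \<open>W = \<alpha> \<xi>\<close> in a neighbourhood, the product rule and \<open>\<nabla>\<^sub>x \<xi> = \<phi> A x\<close> determine \<open>B\<close>.\<close>

locale Hopf_data = codazzi_data +
  assumes T_0: "T = 0" and B_eq: "B x = d x *\<^sub>R \<xi> + \<alpha> *\<^sub>R \<phi> (A x)"
begin

lemma W_eq_xi: "W = \<alpha> *\<^sub>R \<xi>"
  using W_eq T_0 by simp

lemma A_xi: "A \<xi> = \<alpha> *\<^sub>R \<xi>"
  using W_eq_xi by (simp add: W_def)

lemma A_perp: "g x \<xi> = 0 \<Longrightarrow> g (A x) \<xi> = 0"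
  by (simp add: A_sym A_xi form_simps)

lemma Hopf_codazzi:
  assumes "g x \<xi> = 0" "g z \<xi> = 0"
  shows "(c + \<alpha> * \<alpha>) * g (\<phi> (A x)) z + d \<xi> * g (A x) z + \<alpha> * c * g (\<phi> x) z = 0"
  using codazzi[of x \<xi> z] assms
  by (simp add: A_xi form_simps B_eq xi_unit phi_xi sym[of _ z] map_simps g_phi_xi A_perp)
    (simp add: algebra_simps)

lemma Hopf_codazzi_xi:
  "c * (g (\<phi> (A x)) y + g (A (\<phi> x)) y) + 2 * \<alpha> * g (A (\<phi> (A x))) y = 0"
  using codazzi_xi[of x y] by (simp add: W_eq_xi form_simps g_phi_xi)

lemma Hopf_dW:
  assumes "g x \<xi> = 0" "g y \<xi> = 0"
  shows "\<alpha> * (g (\<phi> (A x)) y + g (A (\<phi> x)) y) = 2 * g (A (\<phi> (A x))) y - 2 * c * g (\<phi> x) y"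
proof -
  have "g (\<phi> (A y)) x = - g (A (\<phi> x)) y"
    by (simp add: phi_skew A_sym sym[of y "A (\<phi> x)"])
  moreover have "g \<xi> x = 0" "g \<xi> y = 0"
    using assms by (simp_all add: sym[of \<xi>])
  ultimately show ?thesis
    using dW_eq[of x y] by (simp add: B_eq form_simps algebra_simps)
qed

text \<open>A Hopf hypersurface would have to be one-dimensional. The relation \<open>Hopf_codazzi\<close>, evaluated on the
  plane of \<open>x\<close> and \<open>\<phi> x\<close>, first gives \<open>d \<xi> = 0\<close> and then that \<open>A\<close> is a multiple \<open>k\<close> of the identity on
  the complement of \<open>\<xi>\<close>, with \<open>k * (c + \<alpha> * \<alpha>) = - \<alpha> * c\<close>. But \<open>Hopf_codazzi_xi\<close> requires \<open>\<alpha> * k = - c\<close>, so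
  that \<open>\<alpha> * \<alpha> = c + \<alpha> * \<alpha>\<close>.\<close>

lemma orthogonal_vector_zero:
  assumes "g x \<xi> = 0"
  shows "x = 0"
proof (rule ccontr)
  assume nz: "x \<noteq> 0"
  note perp = assms A_perp[OF assms]
  define y where "y = \<phi> x"
  have y: "g y \<xi> = 0" by (simp add: y_def g_phi_xi)
  have xx: "g x x > 0" and yy: "g y y = g x x" "g x y = 0"
    using pos[OF nz] by (simp_all add: y_def phi_phi_form assms g_phi_self sym[of x "\<phi> x"])
  have py: "\<phi> y = - x"
    by (simp add: y_def phi_phi assms)
  have a_nz: "\<alpha> \<noteq> 0"
  proof
    assume a: "\<alpha> = 0"
    have "g (\<phi> (A x)) (\<phi> (A x)) = 0"
      using Hopf_codazzi[OF assms, of "\<phi> (A x)"] c_nz g_phi_self[of "A x"]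
      by (simp add: a g_phi_xi sym[of "A x"])
    then have "A x = 0"
      by (simp add: phi_phi_form perp eq_0_iff)
    then show False
      using Hopf_dW[OF assms y] c_nz xx by (simp add: a map_simps form_simps yy y_def[symmetric])
  qed
  define q r where "q = c + \<alpha> * \<alpha>" and "r = d \<xi>"
  have r0: "r = 0"
  proof -
    have e1: "q * g (A x) x + r * g (A x) y + \<alpha> * c * g x x = 0"
      using Hopf_codazzi[OF assms y] 
      by (simp add: q_def r_def yy y_def phi_phi_form assms)
    have e2: "- q * g (A x) y + r * g (A x) x = 0"
      using Hopf_codazzi[OF assms assms] 
      by (simp add: q_def[symmetric] r_def phi_skew[of "A x"] g_phi_self y_def)
    have e3: "q * g (A y) y - r * g (A x) y + \<alpha> * c * g x x = 0"
      using Hopf_codazzi[OF y assms] 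
      by (simp add: q_def r_def py phi_skew[of "A y"] form_simps A_sym y_def[symmetric] sym[of y "A x"])
    have e4: "q * g (A x) y + r * g (A y) y = 0"
      using Hopf_codazzi[OF y y]
      by (simp add: q_def r_def phi_skew[of "A y"] form_simps py yy A_sym sym[of y "A x"])
    \<comment> \<open>\<open>e2\<close> and \<open>e4\<close> turn \<open>r\<close> times the left-hand sides of \<open>e1\<close> and \<open>e3\<close> into opposite numbers\<close>
    have "r * g (A y) y = - (q * g (A x) y)"
      using e4 by linarith
    then have "q * (r * g (A x) x) = q * (q * g (A x) y)" "q * (r * g (A y) y) = - q * (q * g (A x) y)"
      using e2 by simp_all
    then have "r * (q * g (A x) x + r * g (A x) y) = (q * q + r * r) * g (A x) y"
      "r * (q * g (A y) y - r * g (A x) y) = - (q * q + r * r) * g (A x) y"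
      by (simp_all add: algebra_simps)
    moreover have "q * g (A x) x + r * g (A x) y = - \<alpha> * c * g x x" "q * g (A y) y - r * g (A x) y = - \<alpha> * c * g x x"
      using e1 e3 by simp_all
    ultimately have "r * (- \<alpha> * c * g x x) = - (r * (- \<alpha> * c * g x x))"
      by (metis mult_minus_left)
    then show ?thesis
      using a_nz c_nz xx by simp
  qed
  have q_nz: "q \<noteq> 0"
    using Hopf_codazzi[OF assms y] r0 a_nz c_nz xx yy
    by (auto simp: q_def r_def y_def)
  define k where "k = - \<alpha> * c / q"
  have A_eq: "A w = k *\<^sub>R w" if w: "g w \<xi> = 0" for w
  proof -
    let ?v = "A w - k *\<^sub>R w"
    have v: "g ?v \<xi> = 0" using w A_perp by (simp add: form_simps)
    have kq: "\<alpha> * c = - (k * q)" using q_nz by (simp add: k_def)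
    have "q * g (\<phi> (A w)) (\<phi> ?v) + \<alpha> * c * g (\<phi> w) (\<phi> ?v) = 0"
      using Hopf_codazzi[OF w g_phi_xi(1), of ?v] r0 by (simp add: q_def r_def)
    then have "q * (g (\<phi> (A w)) (\<phi> ?v) - k * g (\<phi> w) (\<phi> ?v)) = 0"
      unfolding kq by (simp add: right_diff_distrib mult_ac)
    then have "g (\<phi> ?v) (\<phi> ?v) = 0"
      using q_nz by (simp add: left_simps map_simps)
    then have "?v = 0"
      using v by (simp add: phi_phi_form eq_0_iff)
    then show ?thesis by simp
  qed
  have "c * (k * (2 * g x x)) + k * (k * (2 * (g x x * \<alpha>))) = 0"
    using Hopf_codazzi_xi[of x y] 
    by (simp add: A_eq assms y map_simps form_simps yy y_def[symmetric]) (simp add: algebra_simps)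
  then have "2 * g x x * (k * (c + \<alpha> * k)) = 0"
    by algebra
  then have "k * (c + \<alpha> * k) = 0"
    using xx by simp
  moreover have "k \<noteq> 0"
    using a_nz c_nz q_nz by (simp add: k_def)
  ultimately have "\<alpha> * k = - c" by simp
  then have "c * (\<alpha> * \<alpha>) = c * q"
    using q_nz by (simp add: k_def field_simps)
  then show False
    using c_nz by (simp add: q_def)
qed

end


section \<open>The Hermitian form\<close>

lemma bounded_bilinear_smult: "bounded_bilinear (\<lambda>(a :: complex) (V :: complex ^ 'm::finite). a *s V)"
  unfolding bilinear_conv_bounded_bilinear[symmetric] bilinear_def
  by (auto intro!: linearI simp: vec_eq_iff algebra_simps)

interpretation smult: bounded_bilinear "\<lambda>(a :: complex) (V :: complex ^ 'm::finite). a *s V"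
  by (rule bounded_bilinear_smult)

lemma smult_smult: "a *s (b *s V) = (a * b) *s (V :: complex ^ 'm::finite)"
  by (simp add: vec_eq_iff)

lemma scaleR_smult: "r *\<^sub>R V = of_real r *s (V :: complex ^ 'm::finite)"
  by (simp add: vec_eq_iff scaleR_conv_of_real[where 'a = complex])

lemma bounded_bilinear_herm: "bounded_bilinear (herm c)"
  unfolding bilinear_conv_bounded_bilinear[symmetric] bilinear_def herm_def
  by (auto intro!: linearI simp: algebra_simps sum.distrib sum_distrib_left scaleR_conv_of_real[where 'a = complex])

interpretation herm: bounded_bilinear "herm c" for c
  by (rule bounded_bilinear_herm)

lemma herm_smult_left: "herm c (a *s V) W = a * herm c V W"
  and herm_smult_right: "herm c V (a *s W) = cnj a * herm c V W"
  by (simp_all add: herm_def algebra_simps sum_distrib_left)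

lemma herm_cnj: "herm c W V = cnj (herm c V W)"
  by (simp add: herm_def mult_ac)

definition ip :: "real \<Rightarrow> complex ^ ('n::finite option) \<Rightarrow> complex ^ ('n option) \<Rightarrow> real" where
  "ip c V W = Re (herm c V W)"

lemma bounded_bilinear_ip: "bounded_bilinear (ip c)"
  unfolding ip_def[abs_def]
  unfolding bilinear_conv_bounded_bilinear[symmetric] bilinear_def
  by (auto intro!: linearI simp: herm.add_left herm.add_right herm.scaleR_left herm.scaleR_right)

interpretation ip: bounded_bilinear "ip c" for c
  by (rule bounded_bilinear_ip)

lemma ip_commute: "ip c V W = ip c W V"
  unfolding ip_def by (subst herm_cnj) simp

lemma ip_i_left: "ip c (\<i> *s V) W = - ip c V (\<i> *s W)"
  and ip_i_i: "ip c (\<i> *s V) (\<i> *s W) = ip c V W"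
  by (simp_all add: ip_def herm_smult_left herm_smult_right)

lemma ip_i_self: "ip c (\<i> *s V) V = 0"  "ip c V (\<i> *s V) = 0"
  using ip_i_left[of c V V] ip_commute[of c "\<i> *s V" V] by linarith+

lemma herm_eq_ip: "herm c V W = Complex (ip c V W) (ip c V (\<i> *s W))"
  by (simp add: ip_def herm_smult_right complex_eq_iff)

text \<open>For \<open>c = -1\<close> this is the reversed Cauchy-Schwarz inequality: the complement of a timelike line is
  spacelike.\<close>

lemma horizontal_positive:
  fixes Z W :: "complex ^ ('n::finite option)"
  assumes c: "c = 1 \<or> c = -1" and Z: "herm c Z Z = of_real c" and W: "herm c W Z = 0" "W \<noteq> 0"
  shows "ip c W W > 0"
proof -
  have nn: "V * cnj V = of_real ((cmod V)\<^sup>2)" for V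
    using complex_norm_square[of V] by simp
  define wn where "wn = L2_set (\<lambda>i. cmod (W $ Some i)) UNIV"
  define zn where "zn = L2_set (\<lambda>i. cmod (Z $ Some i)) UNIV"
  have herm_self: "herm c V V = of_real (c * (cmod (V $ None))\<^sup>2 + (L2_set (\<lambda>i. cmod (V $ Some i)) UNIV)\<^sup>2)"
    for V :: "complex ^ ('n option)"
    by (simp add: herm_def nn L2_set_def sum_nonneg mult.assoc)
  have W': "W = 0" if "W $ None = 0" "wn = 0"
  proof -
    have "W $ k = 0" for k
      using that by (cases k) (auto simp: wn_def L2_set_eq_0_iff)
    then show ?thesis by (simp add: vec_eq_iff)
  qed
  have wn0: "wn \<ge> 0" "zn \<ge> 0" by (simp_all add: wn_def zn_def)
  show ?thesis
  proof (cases "c = 1")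
    case True
    have "(cmod (W $ None))\<^sup>2 + wn\<^sup>2 > 0"
      using W' W(2) sum_power2_gt_zero_iff by fastforce
    then show ?thesis
      unfolding ip_def herm_self wn_def[symmetric] using True by simp
  next
    case False
    then have c: "c = -1" using c by simp
    have z0: "(cmod (Z $ None))\<^sup>2 = 1 + zn\<^sup>2"
      using Z unfolding herm_self zn_def[symmetric] of_real_eq_iff unfolding c by simp
    have "W $ None * cnj (Z $ None) = (\<Sum>i\<in>UNIV. W $ Some i * cnj (Z $ Some i))"
      using W(1) by (simp add: herm_def c)
    then have "cmod (W $ None) * cmod (Z $ None) = cmod (\<Sum>i\<in>UNIV. W $ Some i * cnj (Z $ Some i))"
      by (metis norm_mult complex_mod_cnj)
    also have "\<dots> \<le> (\<Sum>i\<in>UNIV. \<bar>cmod (W $ Some i)\<bar> * \<bar>cmod (Z $ Some i)\<bar>)"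
      by (rule order_trans[OF norm_sum]) (simp add: norm_mult)
    also have "\<dots> \<le> wn * zn"
      unfolding wn_def zn_def by (rule L2_set_mult_ineq)
    finally have "(cmod (W $ None) * cmod (Z $ None))\<^sup>2 \<le> (wn * zn)\<^sup>2"
      by (intro power_mono) simp_all
    then have le: "(cmod (W $ None))\<^sup>2 * (1 + zn\<^sup>2) \<le> wn\<^sup>2 * zn\<^sup>2"
      by (simp add: power_mult_distrib z0)
    have "wn \<noteq> 0"
    proof
      assume "wn = 0"
      then have "(cmod (W $ None))\<^sup>2 * (1 + zn\<^sup>2) \<le> 0" using le by simp
      moreover have "1 + zn\<^sup>2 > 0" by (simp add: add_pos_nonneg)
      ultimately have "(cmod (W $ None))\<^sup>2 \<le> 0"
        by (simp add: mult_le_0_iff)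
      then show False using W' W(2) \<open>wn = 0\<close> by simp
    qed
    then have "wn\<^sup>2 * zn\<^sup>2 < wn\<^sup>2 * (1 + zn\<^sup>2)" by (simp add: algebra_simps)
    then have "(cmod (W $ None))\<^sup>2 * (1 + zn\<^sup>2) < wn\<^sup>2 * (1 + zn\<^sup>2)" using le by simp
    moreover have "1 + zn\<^sup>2 > 0" by (simp add: add_pos_nonneg)
    ultimately have "(cmod (W $ None))\<^sup>2 < wn\<^sup>2"
      using mult_less_cancel_right_pos by blast
    then show ?thesis
      unfolding ip_def herm_self wn_def[symmetric] unfolding c by simp
  qed
qed


section \<open>Immersions into a space form\<close>

lemma linear_axis_sum:
  fixes h :: "real ^ 'k::finite \<Rightarrow> 'b::real_vector"
  assumes "linear h"
  shows "h x = (\<Sum>i\<in>UNIV. x $ i *\<^sub>R h (axis i 1))"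
proof -
  have "x = (\<Sum>i\<in>UNIV. x $ i *\<^sub>R axis i 1)"
    by (simp add: basis_expansion flip: scalar_mult_eq_scaleR)
  then have "h x = h (\<Sum>i\<in>UNIV. x $ i *\<^sub>R axis i 1)" by simp
  then show ?thesis
    by (simp add: linear_sum[OF assms] linear_scale[OF assms])
qed

locale immersion =
  fixes c :: real and U :: "(real ^ 'k::finite) set"
    and F :: "real ^ 'k \<Rightarrow> complex ^ ('n::finite option)"
  assumes c: "c = 1 \<or> c = -1" and U: "open U" and F: "smooth_on U F"
    and F_in: "F ` U \<subseteq> hyperquadric c" and inj: "\<And>u. u \<in> U \<Longrightarrow> inj (differential c F u)"
begin

definition \<tau> where "\<tau> v u = of_real c * herm c (dir v F u) (F u)"

text \<open>As \<open>\<tau> v\<close> is imaginary, this is a unitary connection on the trivial bundle. It is the differentiation of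
  equivariant fields along the horizontal lift of a curve; the term with \<open>\<tau>\<close> compensates for the
  vertical motion of \<open>F\<close>.\<close>

definition cov where "cov v s u = dir v s u - \<tau> v u *s s u"

definition L where "L v u = differential c F u v"

definition g where "g u x y = ip c (L x u) (L y u)"

text \<open>The curvature of \<open>cov\<close>; see \<open>cov_commute\<close>.\<close>

definition \<rho> where "\<rho> x y u = of_real c * (herm c (L x u) (L y u) - herm c (L y u) (L x u))"

abbreviation "G \<equiv> induced_metric c F"

lemma G_nth: "G u $ i $ j = ip c (L (axis i 1) u) (L (axis j 1) u)"
  by (simp add: induced_metric_def L_def ip_def)

text \<open>The tangential part of an ambient vector, in the coordinates of the chart.\<close>

definition pull where "pull u s = matrix_inv (G u) *v (\<chi> j. ip c s (L (axis j 1) u))"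

lemma c_sq: "of_real c * of_real c = (1::complex)"
  using c by auto

lemma c_sq': "c * c = 1" "c * (c * a) = a" "c \<noteq> 0"
  using c by auto

lemma L_eq_cov: "L v u = cov v F u"
  by (simp add: L_def cov_def \<tau>_def differential_def horizontal_def dir_def)

lemma herm_F_F: "u \<in> U \<Longrightarrow> herm c (F u) (F u) = of_real c"
  using F_in by (auto simp: hyperquadric_def)

lemma smooth_herm: "smooth_on U s \<Longrightarrow> smooth_on U t \<Longrightarrow> smooth_on U (\<lambda>u. herm c (s u) (t u))"
  by (rule herm.smooth_on[OF U])

lemma smooth_ip: "smooth_on U s \<Longrightarrow> smooth_on U t \<Longrightarrow> smooth_on U (\<lambda>u. ip c (s u) (t u))"
  by (rule ip.smooth_on[OF U])

lemma smooth_smult: "smooth_on U (a :: _ \<Rightarrow> complex) \<Longrightarrow> smooth_on U s \<Longrightarrow> smooth_on U (\<lambda>u. a u *s s u)"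
  by (rule smult.smooth_on[OF U])

lemma smooth_tau: "smooth_on U (\<tau> v)"
  unfolding \<tau>_def[abs_def]
  by (intro smooth_on_mult[OF U] smooth_on_const smooth_herm smooth_on_dir F)

lemma smooth_cov: "smooth_on U s \<Longrightarrow> smooth_on U (cov v s)"
  unfolding cov_def[abs_def]
  by (intro smooth_on_diff[OF U] smooth_smult smooth_on_dir smooth_tau)

lemma smooth_L: "smooth_on U (L v)"
  unfolding L_eq_cov[abs_def] by (intro smooth_cov F)

context
  fixes u assumes u: "u \<in> U"
begin

lemma linear_tau: "linear (\<lambda>v. \<tau> v u)"
  using linear_add[OF linear_dir[OF U F u]] linear_scale[OF linear_dir[OF U F u]]
  by (auto intro!: linearI simp: \<tau>_def herm.add_left herm.scaleR_left algebra_simps)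

lemma linear_cov: "smooth_on U s \<Longrightarrow> linear (\<lambda>v. cov v s u)"
  using linear_add[OF linear_dir[OF U _ u, of s]] linear_scale[OF linear_dir[OF U _ u, of s]]
    linear_add[OF linear_tau] linear_scale[OF linear_tau]
  by (auto intro!: linearI simp: cov_def smult.add_left smult.scaleR_left algebra_simps)

lemma linear_L: "linear (\<lambda>v. L v u)"
  unfolding L_eq_cov by (rule linear_cov[OF F])

lemma tau_imaginary: "cnj (\<tau> v u) = - \<tau> v u"
proof -
  have "dir v (\<lambda>u. herm c (F u) (F u)) u = dir v (\<lambda>u. of_real c) u"
    by (rule dir_transform[OF U u]) (rule herm_F_F)
  then have "herm c (F u) (dir v F u) + herm c (dir v F u) (F u) = 0"
    by (simp add: herm.dir[OF U u F F] dir_const)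
  then show ?thesis
    unfolding \<tau>_def by (subst herm_cnj) (simp add: eq_neg_iff_add_eq_0 flip: distrib_left)
qed

lemma herm_L_F: "herm c (L v u) (F u) = 0" "herm c (F u) (L v u) = 0"
proof -
  show "herm c (L v u) (F u) = 0"
  proof -
    have "\<tau> v u * of_real c = (of_real c * of_real c) * herm c (dir v F u) (F u)"
      by (simp add: \<tau>_def)
    then show ?thesis
      by (simp add: L_eq_cov cov_def herm.diff_left herm_smult_left herm_F_F u c_sq)
  qed
  then show "herm c (F u) (L v u) = 0"
    by (subst herm_cnj) simp
qed

lemma ip_F: "ip c (a *s F u) (L v u) = 0" "ip c (L v u) (a *s F u) = 0"
  by (simp_all add: ip_def herm_smult_left herm_smult_right herm_L_F)

text \<open>The horizontal projection does not enter the definition of \<open>cov\<close>; so this holds for all vector fields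
  along \<open>F\<close>, even \<open>F\<close> itself.\<close>

lemma herm_cov:
  assumes "smooth_on U s" "smooth_on U t"
  shows "dir v (\<lambda>u. herm c (s u) (t u)) u = herm c (cov v s u) (t u) + herm c (s u) (cov v t u)"
  by (simp add: herm.dir[OF U u assms] cov_def herm.diff_left herm.diff_right herm_smult_left
      herm_smult_right tau_imaginary)

lemma ip_cov:
  assumes "smooth_on U s" "smooth_on U t"
  shows "dir v (\<lambda>u. ip c (s u) (t u)) u = ip c (cov v s u) (t u) + ip c (s u) (cov v t u)"
  unfolding ip_def
  by (simp add: bounded_linear.dir[OF bounded_linear_Re U u smooth_herm[OF assms]] herm_cov assms)

lemma cov_add:
  "smooth_on U s \<Longrightarrow> smooth_on U t \<Longrightarrow> cov v (\<lambda>u. s u + t u) u = cov v s u + cov v t u"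
  by (simp add: cov_def dir_add[OF U u] smult.add_right)

lemma cov_diff:
  "smooth_on U s \<Longrightarrow> smooth_on U t \<Longrightarrow> cov v (\<lambda>u. s u - t u) u = cov v s u - cov v t u"
  by (simp add: cov_def dir_diff[OF U u] smult.diff_right)

lemma cov_minus: "smooth_on U s \<Longrightarrow> cov v (\<lambda>u. - s u) u = - cov v s u"
  by (simp add: cov_def dir_minus[OF U u] smult.minus_right)

lemma cov_sum:
  assumes "\<And>i. i \<in> I \<Longrightarrow> smooth_on U (s i)"
  shows "cov v (\<lambda>u. \<Sum>i\<in>I. s i u) u = (\<Sum>i\<in>I. cov v (s i) u)"
  by (simp add: cov_def dir_sum[OF U u] assms smult.sum_right sum_subtractf)

lemma cov_smult:
  "smooth_on U a \<Longrightarrow> smooth_on U s \<Longrightarrow>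
    cov v (\<lambda>u. a u *s s u) u = dir v a u *s s u + a u *s cov v s u"
  by (simp add: cov_def smult.dir[OF U u] smult.diff_right smult_smult mult.commute)

lemma cov_const_smult: "smooth_on U s \<Longrightarrow> cov v (\<lambda>u. a *s s u) u = a *s cov v s u"
  using cov_smult[OF smooth_on_const] by (simp add: dir_const)

lemma cov_scaleR:
  "smooth_on U a \<Longrightarrow> smooth_on U s \<Longrightarrow>
    cov v (\<lambda>u. a u *\<^sub>R s u) u = dir v a u *\<^sub>R s u + a u *\<^sub>R cov v s u"
  by (simp add: cov_def bounded_bilinear.dir[OF bounded_bilinear_scaleR U u] smult.scaleR_right
      scaleR_diff_right)

lemma cov_transform: "(\<And>w. w \<in> U \<Longrightarrow> s w = t w) \<Longrightarrow> cov v s u = cov v t u"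
  using dir_transform[OF U u, of s t] u by (simp add: cov_def)

lemma cov_F: "cov v F u = L v u"
  by (simp add: L_eq_cov)

lemma dir_tau: "dir y (\<tau> x) u - dir x (\<tau> y) u = \<rho> x y u"
proof -
  have d: "dir v F u = L v u + \<tau> v u *s F u" for v
    by (simp add: L_eq_cov cov_def)
  have "dir y (\<tau> x) u = of_real c * (herm c (dir x F u) (dir y F u) + herm c (dir y (dir x F) u) (F u))" for x y
    unfolding \<tau>_def[abs_def]
    by (simp add: bounded_linear.dir[OF bounded_linear_mult_right U u] smooth_herm smooth_on_dir F
        herm.dir[OF U u])
  then have "dir y (\<tau> x) u - dir x (\<tau> y) u
    = of_real c * (herm c (dir x F u) (dir y F u) - herm c (dir y F u) (dir x F u))"
    by (simp add: dir_commute[OF U u F, of x y] algebra_simps)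
  also have "herm c (dir x F u) (dir y F u) - herm c (dir y F u) (dir x F u)
    = herm c (L x u) (L y u) - herm c (L y u) (L x u)"
    by (simp add: d herm.add_left herm.add_right herm_smult_left herm_smult_right herm_L_F tau_imaginary)
  finally show ?thesis by (simp add: \<rho>_def)
qed

lemma cov_commute:
  assumes s: "smooth_on U s"
  shows "cov x (cov y s) u - cov y (cov x s) u = \<rho> x y u *s s u"
proof -
  have "dir x (cov y s) u = dir x (dir y s) u - (\<tau> y u *s dir x s u + dir x (\<tau> y) u *s s u)" for x y
    unfolding cov_def[of y s, abs_def]
    by (simp add: dir_diff[OF U u] smult.dir[OF U u] smooth_on_dir smooth_tau smooth_smult s)
  then have "cov x (cov y s) u - cov y (cov x s) u = (dir y (\<tau> x) u - dir x (\<tau> y) u) *s s u"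
    by (simp add: cov_def dir_commute[OF U u s, of x y] smult.diff_right smult.diff_left smult_smult mult.commute)
  then show ?thesis
    by (simp add: dir_tau)
qed

text \<open>Torsion-freeness of the induced connection: \<open>L x\<close> is itself a covariant derivative, that of \<open>F\<close>, and the
  commutator is a multiple of \<open>F\<close>, which is invisible to tangent vectors.\<close>

lemma cov_L_sym: "cov x (L y) u - cov y (L x) u = \<rho> x y u *s F u"
  using cov_commute[OF F] by (simp add: L_eq_cov[abs_def])

lemma ip_cov_L_sym: "ip c (cov x (L y) u) (L z u) = ip c (cov y (L x) u) (L z u)"
proof -
  have "cov x (L y) u = cov y (L x) u + \<rho> x y u *s F u"
    using cov_L_sym[of x y] by (simp add: algebra_simps)
  then show ?thesis by (simp add: ip.add_left ip_F)
qed

lemma L_eq_0_iff: "L x u = 0 \<longleftrightarrow> x = 0"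
proof -
  have "L 0 u = 0" using linear_0[OF linear_L] .
  then show ?thesis
    using injD[OF inj[OF u], of x 0] unfolding L_def by auto
qed

lemma g_pos: "x \<noteq> 0 \<Longrightarrow> g u x x > 0"
  unfolding g_def
  by (rule horizontal_positive[OF c herm_F_F[OF u] herm_L_F(1)]) (simp add: L_eq_0_iff)

lemma g_positive_form: "positive_form (g u)"
proof (rule positive_form.intro)
  show "linear (\<lambda>x. g u x y)" for y
    using linear_add[OF linear_L] linear_scale[OF linear_L]
    by (auto intro!: linearI simp: g_def ip.add_left ip.scaleR_left)
  show "g u x y = g u y x" for x y
    by (simp add: g_def ip_commute)
qed (rule g_pos)

interpretation g: positive_form "g u" by (rule g_positive_form)

lemma G_mult: "(G u *v y) $ i = ip c (L y u) (L (axis i 1) u)"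
  using linear_axis_sum[OF g.linear_left, of y "axis i 1"]
  by (simp add: matrix_vector_mult_def G_nth g_def mult.commute ip_commute)

lemma inner_G: "x \<bullet> (G u *v y) = g u x y"
  using linear_axis_sum[OF g.linear_left, of x y]
  by (simp add: inner_vec_def G_mult g_def ip_commute)

lemma invertible_G: "invertible (G u)"
proof -
  have "y = 0" if "G u *v y = 0" for y
    using inner_G[of y y] g.eq_0_iff that by simp
  then have "inj ((*v) (G u))"
    using matrix_left_invertible_ker matrix_left_invertible_injective by blast
  then show ?thesis
    using invertible_left_inverse matrix_left_invertible_injective by blast
qed

lemma g_pull: "g u (pull u s) y = ip c s (L y u)" "g u y (pull u s) = ip c s (L y u)"
proof -
  have "G u *v pull u s = (\<chi> j. ip c s (L (axis j 1) u))"
    using matrix_inv_inverse(1)[OF invertible_G] by (simp add: pull_def matrix_vector_mul_assoc)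
  then have "g u y (pull u s) = y \<bullet> (\<chi> j. ip c s (L (axis j 1) u))"
    using inner_G by metis
  also have "\<dots> = ip c s (L y u)"
  proof -
    have "linear (\<lambda>y. ip c s (L y u))"
      using linear_add[OF linear_L] linear_scale[OF linear_L]
      by (auto intro!: linearI simp: ip.add_right ip.scaleR_right)
    from linear_axis_sum[OF this, of y] show ?thesis
      by (simp add: inner_vec_def)
  qed
  finally show "g u y (pull u s) = ip c s (L y u)" .
  then show "g u (pull u s) y = ip c s (L y u)"
    by (simp add: g.sym)
qed

lemma pull_eqI: "(\<And>y. ip c s (L y u) = g u x y) \<Longrightarrow> pull u s = x"
  by (subst g.eq_iff) (simp add: g_pull)

lemma pull_L: "pull u (L x u) = x"
  by (rule pull_eqI) (simp add: g_def)

lemma pull_eq_iff: "pull u s = pull u t \<longleftrightarrow> (\<forall>y. ip c s (L y u) = ip c t (L y u))"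
  by (subst g.eq_iff) (simp add: g_pull)

lemma linear_pull: "linear (pull u)"
  by (rule linearI) (rule pull_eqI; simp add: g.left_simps g_pull ip.add_left ip.scaleR_left)+

lemma pull_F: "pull u (a *s F u) = 0"
  by (rule pull_eqI) (simp add: ip_F g.left_simps)

end

lemma smooth_pull:
  assumes "smooth_on U s"
  shows "smooth_on U (\<lambda>u. pull u (s u))"
  unfolding pull_def
  using assms by (intro smooth_on_linear_system[OF U] invertible_G)
    (simp_all add: G_nth smooth_ip smooth_L)

end


context immersion
begin

text \<open>A smooth bundle map from the tangent bundle, such as the differential or its composition with the shape
  operator. It is given by its values on constant fields.\<close>

definition family where
  "family M \<longleftrightarrow> (\<forall>y. smooth_on U (M y)) \<and> (\<forall>u\<in>U. linear (\<lambda>y. M y u))"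

lemma family_L: "family L"
  by (simp add: family_def smooth_L linear_L)

lemma family_smooth: "family M \<Longrightarrow> smooth_on U (M y)"
  by (simp add: family_def)

lemma smooth_family:
  fixes M :: "real ^ 'k \<Rightarrow> real ^ 'k \<Rightarrow> 'b::real_normed_vector"
  assumes "family M" "smooth_on U Y"
  shows "smooth_on U (\<lambda>u. M (Y u) u)"
proof (rule smooth_on_cong[OF U])
  show "(\<Sum>i\<in>UNIV. Y u $ i *\<^sub>R M (axis i 1) u) = M (Y u) u" if "u \<in> U" for u
    using linear_axis_sum[of "\<lambda>y. M y u" "Y u"] assms(1) that by (simp add: family_def)
  show "smooth_on U (\<lambda>u. \<Sum>i\<in>UNIV. Y u $ i *\<^sub>R M (axis i 1) u)"
    using assms by (intro smooth_on_sum smooth_on_scaleR smooth_on_vec_nth U) (simp_all add: family_def)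
qed

lemma cov_family:
  fixes M :: "real ^ 'k \<Rightarrow> real ^ 'k \<Rightarrow> complex ^ ('n option)"
  assumes u: "u \<in> U" and M: "family M" and Y: "smooth_on U Y"
  shows "cov x (\<lambda>w. M (Y w) w) u = M (dir x Y u) u + cov x (M (Y u)) u"
proof -
  have lin: "M y w = (\<Sum>i\<in>UNIV. y $ i *\<^sub>R M (axis i 1) w)" if "w \<in> U" for y w
    using linear_axis_sum[of "\<lambda>y. M y w" y] M that by (simp add: family_def)
  have *: "cov x (\<lambda>w. M (Z w) w) u
      = M (dir x Z u) u + (\<Sum>i\<in>UNIV. Z u $ i *\<^sub>R cov x (M (axis i 1)) u)"
    if Z: "smooth_on U Z" for Z
  proof -
    have Zi: "smooth_on U (\<lambda>w. Z w $ i)" for i by (rule smooth_on_vec_nth[OF U Z])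
    have "cov x (\<lambda>w. M (Z w) w) u = cov x (\<lambda>w. \<Sum>i\<in>UNIV. Z w $ i *\<^sub>R M (axis i 1) w) u"
      by (rule cov_transform[OF u]) (rule lin)
    also have "\<dots> = (\<Sum>i\<in>UNIV. cov x (\<lambda>w. Z w $ i *\<^sub>R M (axis i 1) w) u)"
      by (rule cov_sum[OF u]) (intro smooth_on_scaleR U Zi family_smooth[OF M])
    also have "\<dots> = (\<Sum>i\<in>UNIV. dir x Z u $ i *\<^sub>R M (axis i 1) u + Z u $ i *\<^sub>R cov x (M (axis i 1)) u)"
      by (simp add: cov_scaleR[OF u Zi family_smooth[OF M]] bounded_linear.dir[OF bounded_linear_vec_nth U u Z])
    also have "\<dots> = M (dir x Z u) u + (\<Sum>i\<in>UNIV. Z u $ i *\<^sub>R cov x (M (axis i 1)) u)"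
      using lin[OF u, of "dir x Z u"] by (simp add: sum.distrib)
    finally show ?thesis .
  qed
  have "M 0 u = 0"
    using M u linear_0[of "\<lambda>y. M y u"] by (simp add: family_def)
  then show ?thesis
    using *[OF Y] *[OF smooth_on_const, of "Y u"] by (simp add: dir_const)
qed

lemma linear_cov_L: "u \<in> U \<Longrightarrow> linear (\<lambda>y. cov x (L y) u)"
proof (rule linearI)
  fix y z :: "real ^ 'k" and r :: real
  assume u: "u \<in> U"
  show "cov x (L (y + z)) u = cov x (L y) u + cov x (L z) u"
    using cov_transform[OF u, of "L (y + z)" "\<lambda>w. L y w + L z w"] linear_add[OF linear_L]
    by (simp add: cov_add[OF u] smooth_L)
  show "cov x (L (r *\<^sub>R y)) u = r *\<^sub>R cov x (L y) u"
    using cov_transform[OF u, of "L (r *\<^sub>R y)" "\<lambda>w. r *\<^sub>R L y w"] linear_scale[OF linear_L]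
    by (simp add: cov_scaleR[OF u] smooth_on_const smooth_L dir_const)
qed

text \<open>The Koszul formula: the three derivatives of the metric coefficients expand by the product rule into six
  terms, and four of them cancel by torsion-freeness.\<close>

lemma christoffel_eq:
  assumes u: "u \<in> U"
  shows "christoffel G u l i j = pull u (cov (axis i 1) (L (axis j 1)) u) $ l"
proof -
  have d: "partial_deriv i (\<lambda>w. G w $ m $ j) u
      = ip c (cov (axis i 1) (L (axis m 1)) u) (L (axis j 1) u)
        + ip c (cov (axis i 1) (L (axis j 1)) u) (L (axis m 1) u)" for i j m
    by (simp add: partial_deriv_def dir_def[symmetric] G_nth ip_cov[OF u] smooth_L ip_commute)
  have "partial_deriv i (\<lambda>w. G w $ m $ j) u + partial_deriv j (\<lambda>w. G w $ i $ m) u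
      - partial_deriv m (\<lambda>w. G w $ i $ j) u
      = 2 * ip c (cov (axis i 1) (L (axis j 1)) u) (L (axis m 1) u)" for m
    using ip_cov_L_sym[OF u, of "axis i 1" "axis m 1" "axis j 1"]
      ip_cov_L_sym[OF u, of "axis j 1" "axis m 1" "axis i 1"]
      ip_cov_L_sym[OF u, of "axis j 1" "axis i 1" "axis m 1"]
    unfolding d by linarith
  then show ?thesis
    unfolding christoffel_def pull_def by (simp add: matrix_vector_mult_def sum_divide_distrib)
qed

lemma nabla_eq:
  assumes u: "u \<in> U" and Y: "smooth_on U Y"
  shows "nabla G X Y u = pull u (cov (X u) (\<lambda>w. L (Y w) w) u)"
proof -
  have "pull u (cov x (L y) u) $ l
      = (\<Sum>i\<in>UNIV. \<Sum>j\<in>UNIV. christoffel G u l i j * x $ i * y $ j)" for x y l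
  proof -
    have 1: "linear (\<lambda>x. pull u (cov x (L y) u) $ l)" for y
      using linear_compose[OF linear_compose[OF linear_cov[OF u smooth_L] linear_pull[OF u]]
        bounded_linear.linear[OF bounded_linear_vec_nth]] by (simp add: o_def)
    have 2: "linear (\<lambda>y. pull u (cov x (L y) u) $ l)" for x
      using linear_compose[OF linear_compose[OF linear_cov_L[OF u] linear_pull[OF u]]
        bounded_linear.linear[OF bounded_linear_vec_nth]] by (simp add: o_def)
    show ?thesis
      by (subst linear_axis_sum[OF 1], subst linear_axis_sum[OF 2])
        (simp add: christoffel_eq[OF u] sum_distrib_left mult_ac)
  qed
  then have "(\<chi> l. \<Sum>i\<in>UNIV. \<Sum>j\<in>UNIV. christoffel G u l i j * X u $ i * Y u $ j)
      = pull u (cov (X u) (L (Y u)) u)"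
    by (simp add: vec_eq_iff)
  then show ?thesis
    by (simp add: nabla_def dir_def[symmetric] cov_family[OF u family_L Y] linear_add[OF linear_pull[OF u]]
        pull_L[OF u])
qed

lemma nabla_cong:
  assumes u: "u \<in> U" and Y: "\<And>w. w \<in> U \<Longrightarrow> Y w = Y' w" and X: "X u = X' u"
  shows "nabla G X Y u = nabla G X' Y' u"
  using dir_cong[OF U u Y] Y[OF u] X by (simp add: nabla_def)

text \<open>Constant fields commute. Thus, on constant fields, the second term in \<open>nabla_endo\<close> cancels from the
  Codazzi equation for \<open>R\<^sub>\<xi>\<close>, and \<open>R\<^sub>\<xi>\<close> is needed on constant fields only.\<close>

lemma nabla_const_commute: "nabla G (\<lambda>_. x) (\<lambda>_. y) = nabla G (\<lambda>_. y) (\<lambda>_. x)"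
proof -
  have G_sym: "(\<lambda>w. G w $ i $ j) = (\<lambda>w. G w $ j $ i)" for i j
    by (simp add: G_nth ip_commute)
  have sym: "christoffel G u l i j = christoffel G u l j i" for u l i j
  proof -
    have "partial_deriv i (\<lambda>w. G w $ m $ j) u + partial_deriv j (\<lambda>w. G w $ i $ m) u
        - partial_deriv m (\<lambda>w. G w $ i $ j) u
      = partial_deriv j (\<lambda>w. G w $ m $ i) u + partial_deriv i (\<lambda>w. G w $ j $ m) u
        - partial_deriv m (\<lambda>w. G w $ j $ i) u" for m
      using G_sym[of m j] G_sym[of i m] G_sym[of i j] by simp
    then show ?thesis
      unfolding christoffel_def by simp
  qed
  have "(\<Sum>i\<in>UNIV. \<Sum>j\<in>UNIV. christoffel G u l i j * x $ i * y $ j)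
      = (\<Sum>i\<in>UNIV. \<Sum>j\<in>UNIV. christoffel G u l i j * y $ i * x $ j)" for u l
    by (subst sum.swap) (subst sym, simp add: mult_ac)
  then show ?thesis
    by (simp add: nabla_def[abs_def])
qed

end


section \<open>Hypersurfaces\<close>

locale hypersurface_chart = immersion c U F
  for c :: real and U :: "(real ^ 'k::finite) set"
    and F :: "real ^ 'k \<Rightarrow> complex ^ ('n::finite option)" +
  fixes N :: "real ^ 'k \<Rightarrow> complex ^ ('n option)"
  assumes card: "CARD('k) + 1 = 2 * CARD('n)" and normal: "unit_normal_field c U F N"
begin

lemma N: "smooth_on U N"
  using normal by (simp add: unit_normal_field_def)

definition \<xi> where "\<xi> u = pull u (- (\<i> *s N u))"
definition A where "A v u = - pull u (cov v N u)"
definition \<phi> where "\<phi> u x = pull u (\<i> *s L x u)"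
definition W where "W u = A (\<xi> u) u"
definition \<eta> where "\<eta> v u = g u v (\<xi> u)"

lemma smooth_iN: "smooth_on U (\<lambda>u. - (a *s N u))"
  by (intro smooth_on_minus[OF U] smooth_smult smooth_on_const N)

lemma smooth_xi: "smooth_on U \<xi>"
  unfolding \<xi>_def[abs_def] by (intro smooth_pull smooth_iN)

lemma smooth_A: "smooth_on U (A v)"
  unfolding A_def[abs_def] by (intro smooth_on_minus[OF U] smooth_pull smooth_cov N)

context
  fixes u assumes u: "u \<in> U"
begin

interpretation g: positive_form "g u" by (rule g_positive_form[OF u])

lemma herm_N_F: "herm c (N u) (F u) = 0" "herm c (F u) (N u) = 0"
proof -
  show "herm c (N u) (F u) = 0"
    using normal u by (auto simp: unit_normal_field_def horizontal_space_def)
  then show "herm c (F u) (N u) = 0"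
    by (subst herm_cnj) simp
qed

lemma ip_N: "ip c (N u) (N u) = 1" "ip c (N u) (L v u) = 0" "ip c (L v u) (N u) = 0"
  using normal u ip_commute[of c "L v u" "N u"]
  by (simp_all add: unit_normal_field_def ip_def L_def)

lemma ip_F_N: "ip c (a *s F u) (N u) = 0" "ip c (N u) (a *s F u) = 0" "ip c (a *s F u) (b *s N u) = 0" 
   "ip c (b *s N u) (a *s F u) = 0"
  by (simp_all add: ip_def herm_smult_left herm_smult_right herm_N_F)

text \<open>The map in question is injective, and the dimensions agree: \<open>CARD('k) + 1 + 2 = 2 * (CARD('n) + 1)\<close>.\<close>

lemma frame_surjective: "\<exists>v t z. s = L v u + t *\<^sub>R N u + z *s F u"
proof -
  define \<Phi> where "\<Phi> = (\<lambda>(v, t :: real, z :: complex). L v u + t *\<^sub>R N u + z *s F u)"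
  have lin: "linear \<Phi>"
    using linear_add[OF linear_L[OF u]] linear_scale[OF linear_L[OF u]]
    by (auto intro!: linearI simp: \<Phi>_def smult.add_left smult.scaleR_left algebra_simps)
  have inj_\<Phi>: "inj \<Phi>"
    unfolding linear_injective_0[OF lin]
  proof (intro allI impI)
    fix p assume p: "\<Phi> p = 0"
    obtain v t z where vtz: "p = (v, t, z)" by (cases p)
    have 0: "L v u + t *\<^sub>R N u + z *s F u = 0" using p by (simp add: \<Phi>_def vtz)
    have "herm c (L v u + t *\<^sub>R N u + z *s F u) (F u) = 0" by (simp add: 0 herm.zero_left)
    then have z: "z = 0"
      using c_sq'(3) by (simp add: herm.add_left herm.scaleR_left herm_smult_left herm_L_F[OF u] herm_N_F
         herm_F_F[OF u])
    have "ip c (L v u + t *\<^sub>R N u + z *s F u) (N u) = 0" by (simp add: 0 ip.zero_left)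
    then have t: "t = 0"
      by (simp add: ip.add_left ip.scaleR_left ip_N ip_F_N)
    show "p = 0"
      using 0 L_eq_0_iff[OF u] by (simp add: vtz z t smult.zero_left zero_prod_def)
  qed
  have "dim (range \<Phi>) = DIM(complex ^ ('n option))"
    using dim_image_eq[OF lin, of UNIV] inj_\<Phi> card by (simp add: card_option)
  then have "span (range \<Phi>) = UNIV"
    using dim_eq_full by blast
  moreover have "span (range \<Phi>) = range \<Phi>"
    using linear_subspace_image[OF lin subspace_UNIV] span_eq_iff by blast
  ultimately have "s \<in> range \<Phi>" by auto
  then show ?thesis
    by (auto simp: \<Phi>_def)
qed

lemma decompose_frame:
  "s = L (pull u s) u + ip c s (N u) *\<^sub>R N u + (of_real c * herm c s (F u)) *s F u"
proof -
  obtain v t z where s: "s = L v u + t *\<^sub>R N u + z *s F u" using frame_surjective by blast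
  have "pull u s = v"
    by (rule pull_eqI[OF u]) (simp add: s ip.add_left ip.scaleR_left ip_N ip_F[OF u] g_def)
  moreover have "ip c s (N u) = t"
    by (simp add: s ip.add_left ip.scaleR_left ip_N ip_F_N)
  moreover have "of_real c * herm c s (F u) = z"
    using c_sq by (simp add: s herm.add_left herm.scaleR_left herm_smult_left herm_L_F[OF u] herm_N_F
         herm_F_F[OF u] mult.left_commute)
  ultimately show ?thesis using s by simp
qed

lemma pull_N: "pull u (N u) = 0"
  by (rule pull_eqI[OF u]) (simp add: ip_N g.left_simps)

lemma L_xi: "L (\<xi> u) u = - (\<i> *s N u)"
  using decompose_frame[of "- (\<i> *s N u)"]
  by (simp add: \<xi>_def herm.minus_left herm_smult_left herm_N_F ip.minus_left ip_i_self smult.zero_left)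

lemma structure_field: "structure_field c F N u = \<xi> u"
  unfolding structure_field_def
proof (rule the_equality)
  show "differential c F u (\<xi> u) = - (\<i> *s N u)"
    using L_xi by (simp add: L_def)
  show "v = \<xi> u" if "differential c F u v = - (\<i> *s N u)" for v
    using injD[OF inj[OF u], of v "\<xi> u"] that L_xi by (simp add: L_def)
qed

lemma eta_eq: "\<eta> v u = - ip c (L v u) (\<i> *s N u)"
  by (simp add: \<eta>_def g_def L_xi ip.minus_right)

lemma herm_N_L: "herm c (N u) (L v u) = \<i> * of_real (\<eta> v u)"
  using ip_i_left[of c "N u" "L v u"] ip_commute[of c "L v u" "\<i> *s N u"] 
  by (simp add: herm_eq_ip ip_N eta_eq complex_eq_iff)

text \<open>The decomposition of the complex structure into its tangential part \<open>\<phi>\<close> and its normal part.\<close>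

lemma iL: "\<i> *s L x u = L (\<phi> u x) u + \<eta> x u *\<^sub>R N u"
  using decompose_frame[of "\<i> *s L x u"]
  by (simp add: \<phi>_def herm_smult_left herm_L_F[OF u] smult.zero_left ip_i_left eta_eq)

lemma phi_eq: "g u (\<phi> u x) y = ip c (\<i> *s L x u) (L y u)"
  by (simp add: \<phi>_def g_pull[OF u])

lemma xi_unit: "g u (\<xi> u) (\<xi> u) = 1"
  by (simp add: g_def L_xi ip.minus_left ip.minus_right ip_i_i ip_N)

lemma phi_xi: "\<phi> u (\<xi> u) = 0"
  unfolding \<phi>_def
  by (rule pull_eqI[OF u]) (simp add: L_xi smult.minus_right smult_smult ip_N g.left_simps)

lemma phi_skew: "g u (\<phi> u x) y = - g u x (\<phi> u y)"
proof -
  have "g u x (\<phi> u y) = ip c (L x u) (\<i> *s L y u)"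
    unfolding g.sym[of x] phi_eq by (rule ip_commute)
  then show ?thesis
    by (simp add: phi_eq ip_i_left)
qed

lemma phi_phi: "\<phi> u (\<phi> u x) = - x + g u x (\<xi> u) *\<^sub>R \<xi> u"
proof -
  have "\<i> *s L (\<phi> u x) u = \<i> *s (\<i> *s L x u) - \<eta> x u *\<^sub>R (\<i> *s N u)"
    by (simp add: iL smult.add_right smult.scaleR_right)
  also have "\<dots> = L (- x + \<eta> x u *\<^sub>R \<xi> u) u"
    by (simp add: smult_smult L_xi linear_add[OF linear_L[OF u]] linear_diff[OF linear_L[OF u]]
       linear_scale[OF linear_L[OF u]] smult.minus_left)
  finally show ?thesis
    using pull_L[OF u] by (simp add: \<phi>_def \<eta>_def)
qed

lemma linear_phi: "linear (\<phi> u)"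
  using linear_add[OF linear_L[OF u]] linear_scale[OF linear_L[OF u]]
    linear_add[OF linear_pull[OF u]] linear_scale[OF linear_pull[OF u]]
  by (auto intro!: linearI simp: \<phi>_def smult.add_right smult.scaleR_right)

lemma linear_A: "linear (\<lambda>x. A x u)"
  using linear_add[OF linear_cov[OF u N]] linear_scale[OF linear_cov[OF u N]]
    linear_add[OF linear_pull[OF u]] linear_scale[OF linear_pull[OF u]]
  by (auto intro!: linearI simp: A_def)

text \<open>The Weingarten formula. The component along \<open>F\<close> comes from differentiating \<open>herm c N F = 0\<close>.\<close>

lemma cov_N: "cov v N u = - L (A v u) u - (of_real c * (\<i> * of_real (\<eta> v u))) *s F u"
proof -
  have "dir v (\<lambda>w. ip c (N w) (N w)) u = dir v (\<lambda>w. 1) u"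
    using hypersurface_chart.ip_N(1)[OF hypersurface_chart_axioms] by (intro dir_transform[OF U u]) simp
  then have 1: "ip c (cov v N u) (N u) = 0"
    by (simp add: ip_cov[OF u N N] dir_const ip_commute)
  have "dir v (\<lambda>w. herm c (N w) (F w)) u = dir v (\<lambda>w. 0) u"
    using hypersurface_chart.herm_N_F(1)[OF hypersurface_chart_axioms] by (intro dir_transform[OF U u]) simp
  then have 2: "herm c (cov v N u) (F u) = - (\<i> * of_real (\<eta> v u))"
    by (simp add: herm_cov[OF u N F] dir_const cov_F[OF u] herm_N_L eq_neg_iff_add_eq_0)
  have "L (A v u) u = - L (pull u (cov v N u)) u"
    by (simp add: A_def linear_neg[OF linear_L[OF u]])
  then show ?thesis
    using decompose_frame[of "cov v N u"] by (simp add: 1 2 smult.minus_left)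
qed

lemma ip_cov_N: "ip c (cov v N u) (L y u) = - g u (A v u) y"
  by (simp add: cov_N ip.diff_left ip.minus_left ip_F[OF u] g_def)

lemma A_sym: "g u (A x u) y = g u x (A y u)"
proof -
  have *: "g u (A x u) y = ip c (N u) (cov x (L y) u)" for x y
  proof -
    have "dir x (\<lambda>w. ip c (N w) (L y w)) u = dir x (\<lambda>w. 0) u"
      using hypersurface_chart.ip_N(2)[OF hypersurface_chart_axioms] by (intro dir_transform[OF U u]) simp
    then show ?thesis
      by (simp add: ip_cov[OF u N smooth_L] dir_const ip_cov_N)
  qed
  have "cov x (L y) u = cov y (L x) u + \<rho> x y u *s F u"
    using cov_L_sym[OF u, of x y] by (simp add: algebra_simps)
  then have "ip c (N u) (cov x (L y) u) = ip c (N u) (cov y (L x) u)"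
    by (simp add: ip.add_right ip_F_N)
  then show ?thesis
    using * by (simp add: g.sym[of x])
qed

text \<open>The curvature of \<open>cov\<close> is a multiple of the Kaehler form.\<close>

lemma rho_eq: "\<rho> x y u = - of_real (2 * c * g u (\<phi> u x) y) * \<i>"
proof -
  have "herm c (L y u) (L x u) = cnj (herm c (L x u) (L y u))" by (rule herm_cnj)
  then show ?thesis
    by (simp add: \<rho>_def herm_eq_ip phi_eq ip_i_left complex_eq_iff)
qed

end

end


section \<open>The structure equations and the structure Jacobi operator\<close>

context hypersurface_chart
begin

definition \<alpha> where "\<alpha> u = g u (W u) (\<xi> u)"
definition \<omega> where "\<omega> v u = g u v (W u)"
definition LA where "LA v u = L (A v u) u"
definition LW where "LW u = L (W u) u"
definition B where "B u x = pull u (cov x LW u)"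

lemma smooth_i: "smooth_on U s \<Longrightarrow> smooth_on U (\<lambda>u. \<i> *s s u)" 
  by (intro smooth_smult smooth_on_const)

lemma smooth_g: "smooth_on U X \<Longrightarrow> smooth_on U Y \<Longrightarrow> smooth_on U (\<lambda>u. g u (X u) (Y u))"
  unfolding g_def by (intro smooth_ip smooth_family[OF family_L])

lemma family_A: "family A"
  by (simp add: family_def smooth_A linear_A)

lemma smooth_W: "smooth_on U W"
  unfolding W_def[abs_def] by (intro smooth_family[OF family_A] smooth_xi)

lemma smooth_LW: "smooth_on U LW"
  unfolding LW_def[abs_def] by (intro smooth_family[OF family_L] smooth_W)

lemma smooth_eta: "smooth_on U (\<eta> v)" and smooth_omega: "smooth_on U (\<omega> v)"
  and smooth_alpha: "smooth_on U \<alpha>"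
  unfolding \<eta>_def[abs_def] \<omega>_def[abs_def] \<alpha>_def[abs_def]
  by (intro smooth_g smooth_xi smooth_W smooth_on_const)+

lemma family_LA: "family LA"
proof -
  have "linear (\<lambda>y. LA y u)" if "u \<in> U" for u
    using linear_compose[OF linear_A[OF that] linear_L[OF that]] by (simp add: LA_def o_def)
  moreover have "smooth_on U (LA y)" for y
    unfolding LA_def[abs_def] by (intro smooth_family[OF family_L] smooth_A)
  ultimately show ?thesis
    by (simp add: family_def)
qed

lemmas smooth_LA = family_smooth[OF family_LA]

lemma smooth_phi: "smooth_on U Y \<Longrightarrow> smooth_on U (\<lambda>u. \<phi> u (Y u))"
  unfolding \<phi>_def by (intro smooth_pull smooth_i smooth_family[OF family_L])

context
  fixes u assumes u: "u \<in> U"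
begin

interpretation g: positive_form "g u" by (rule g_positive_form[OF u])

lemmas pull_simps = linear_add[OF linear_pull[OF u]] linear_diff[OF linear_pull[OF u]]
  linear_neg[OF linear_pull[OF u]] linear_scale[OF linear_pull[OF u]] linear_0[OF linear_pull[OF u]]

lemma i_cov_N: "\<i> *s cov x N u = - (\<i> *s LA x u) + of_real (c * \<eta> x u) *s F u"
  by (simp add: cov_N[OF u] smult.diff_right smult.minus_right smult.minus_left smult_smult LA_def mult.left_commute)

lemma pull_cov_N: "pull u (cov x N u) = - A x u"
  by (simp add: A_def)

lemma pull_i_LA: "pull u (\<i> *s LA x u) = \<phi> u (A x u)"
  by (simp add: LA_def \<phi>_def)

lemma pull_i_cov_N: "pull u (\<i> *s cov x N u) = - \<phi> u (A x u)"
  by (simp add: i_cov_N pull_simps pull_i_LA pull_F[OF u])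

lemma pull_iN: "pull u (\<i> *s N u) = - \<xi> u"
  by (simp add: \<xi>_def pull_simps)

lemma omega_eq: "\<omega> v u = g u (A v u) (\<xi> u)"
  by (simp add: \<omega>_def W_def A_sym[OF u])

lemma ip_cov_L_sym_iN: "ip c (cov x (L y) u) (\<i> *s N u) = ip c (cov y (L x) u) (\<i> *s N u)"
proof -
  have "cov x (L y) u = cov y (L x) u + \<rho> x y u *s F u"
    using cov_L_sym[OF u, of x y] by (simp add: algebra_simps)
  then show ?thesis
    by (simp add: ip.add_left ip_F_N[OF u])
qed

lemma dir_eta: "dir x (\<eta> v) u - dir v (\<eta> x) u = g u (\<phi> u (A x u)) v - g u (\<phi> u (A v u)) x"
proof -
  have *: "dir x (\<eta> v) u = - ip c (cov x (L v) u) (\<i> *s N u) + g u (\<phi> u (A x u)) v" for x v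
  proof -
    have "dir x (\<eta> v) u = dir x (\<lambda>w. - ip c (L v w) (\<i> *s N w)) u"
      by (rule dir_transform[OF U u]) (rule eta_eq)
    also have "\<dots> = - (ip c (cov x (L v) u) (\<i> *s N u) + ip c (L v u) (\<i> *s cov x N u))"
      by (simp add: dir_minus[OF U u] smooth_ip smooth_L smooth_i N ip_cov[OF u] cov_const_smult[OF u])
    also have "ip c (L v u) (\<i> *s cov x N u) = - g u (\<phi> u (A x u)) v"
      by (simp add: i_cov_N ip.add_right ip.diff_right ip.minus_right ip_F[OF u] phi_eq[OF u] LA_def ip_commute)
    finally show ?thesis by simp
  qed
  show ?thesis
    unfolding *[of x v] *[of v x] ip_cov_L_sym_iN[of x v] by simp
qed

text \<open>The Codazzi equation of the hypersurface, with its normal component and its component along \<open>F\<close>. As \<open>L A\<close>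
  differs from \<open>- cov N\<close> by a multiple of \<open>F\<close>, it follows from the commutator of two covariant
  derivatives of \<open>N\<close>.\<close>

lemma cov_LA_diff:
  "cov x (LA v) u - cov v (LA x) u = of_real (2 * c * g u (\<phi> u x) v) *s (\<i> *s N u)
     - (of_real (c * (dir x (\<eta> v) u - dir v (\<eta> x) u)) * \<i>) *s F u
     - of_real c *s (\<i> *s (\<eta> v u *\<^sub>R L x u - \<eta> x u *\<^sub>R L v u))"
proof -
  have *: "cov x (LA v) u = - cov x (cov v N) u - (of_real (c * dir x (\<eta> v) u) * \<i>) *s F u
      - of_real c *s (\<i> *s (\<eta> v u *\<^sub>R L x u))" for x v
  proof -
    have s: "smooth_on U (\<lambda>w. \<eta> v w *\<^sub>R F w)"
      by (intro smooth_on_scaleR U smooth_eta F)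
    have "LA v w = - cov v N w - (of_real c * \<i>) *s (\<eta> v w *\<^sub>R F w)" if "w \<in> U" for w
      by (simp add: cov_N[OF that] LA_def scaleR_smult smult_smult mult_ac)
    then have "cov x (LA v) u = cov x (\<lambda>w. - cov v N w - (of_real c * \<i>) *s (\<eta> v w *\<^sub>R F w)) u"
      by (rule cov_transform[OF u])
    also have "\<dots> = - cov x (cov v N) u - (of_real c * \<i>) *s (dir x (\<eta> v) u *\<^sub>R F u + \<eta> v u *\<^sub>R L x u)"
      by (simp add: cov_diff[OF u] cov_minus[OF u] smooth_on_minus[OF U] smooth_cov N smooth_smult smooth_on_const
          s cov_const_smult[OF u] cov_scaleR[OF u] smooth_eta F cov_F[OF u])
    finally show ?thesis
      by (simp add: smult.add_right scaleR_smult smult_smult mult_ac algebra_simps)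
  qed
  have "cov x (LA v) u - cov v (LA x) u = - (cov x (cov v N) u - cov v (cov x N) u)
     - (of_real (c * (dir x (\<eta> v) u - dir v (\<eta> x) u)) * \<i>) *s F u
     - of_real c *s (\<i> *s (\<eta> v u *\<^sub>R L x u - \<eta> x u *\<^sub>R L v u))"
    unfolding * by (simp add: algebra_simps smult.diff_right smult.diff_left)
  then show ?thesis
    by (simp add: cov_commute[OF u N] rho_eq[OF u] smult_smult smult.minus_left)
qed

lemma pull_smult_real: "pull u (of_real r *s V) = r *\<^sub>R pull u V"
  by (simp add: pull_simps flip: scaleR_smult)

lemma pull_cov_LA_diff:
  "pull u (cov x (LA v) u) - pull u (cov v (LA x) u)
    = - (2 * c * g u (\<phi> u x) v) *\<^sub>R \<xi> u - c *\<^sub>R (\<eta> v u *\<^sub>R \<phi> u x - \<eta> x u *\<^sub>R \<phi> u v)"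
proof -
  have "pull u (cov x (LA v) u) - pull u (cov v (LA x) u) = pull u (cov x (LA v) u - cov v (LA x) u)"
    by (simp add: pull_simps)
  then show ?thesis
    unfolding cov_LA_diff 
    by (simp only: pull_simps pull_smult_real pull_iN pull_F[OF u] smult.diff_right smult.scaleR_right \<phi>_def[symmetric])
      (simp add: scaleR_diff_right mult.commute)
qed

text \<open>Multiplication by \<open>\<i>\<close> turns the multiples of \<open>\<i> N\<close> and \<open>\<i> L\<close> in the Codazzi equation into normal and
  tangent vectors. Since \<open>L \<xi> = - \<i> N\<close>, the result is the part of the curvature \<open>R(x, v) \<xi>\<close> that comes from
  the ambient space.\<close>

lemma pull_i_cov_LA_diff:
  "pull u (\<i> *s (cov x (LA v) u - cov v (LA x) u)) = c *\<^sub>R (\<eta> v u *\<^sub>R x - \<eta> x u *\<^sub>R v)"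
proof -
  have "\<i> *s (cov x (LA v) u - cov v (LA x) u)
    = - (2 * c * g u (\<phi> u x) v) *\<^sub>R N u + of_real (c * (dir x (\<eta> v) u - dir v (\<eta> x) u)) *s F u
     + of_real c *s (\<eta> v u *\<^sub>R L x u - \<eta> x u *\<^sub>R L v u)"
    unfolding cov_LA_diff
    by (simp add: smult.diff_right smult_smult scaleR_smult mult_ac smult.minus_left)
  then show ?thesis
    by (simp only: pull_simps pull_smult_real pull_N[OF u] pull_F[OF u] pull_L[OF u]) simp
qed

lemma nabla_xi: "nabla G X \<xi> u = \<phi> u (A (X u) u)"
proof -
  have "cov x (\<lambda>w. L (\<xi> w) w) u = - (\<i> *s cov x N u)" for x
  proof -
    have "cov x (\<lambda>w. L (\<xi> w) w) u = cov x (\<lambda>w. - (\<i> *s N w)) u"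
      by (rule cov_transform[OF u]) (rule L_xi)
    then show ?thesis
      by (simp add: cov_minus[OF u] smooth_i N cov_const_smult[OF u])
  qed
  then show ?thesis
    by (simp add: nabla_eq[OF u smooth_xi] pull_simps pull_i_cov_N)
qed

text \<open>For \<open>Y = \<xi>\<close> and for constant \<open>Y\<close> this gives the second covariant derivatives of \<open>\<xi>\<close>, because \<open>\<phi> A Y\<close> is
  the derivative of \<open>\<xi>\<close> along \<open>Y\<close>.\<close>

lemma nabla_phi_A:
  assumes Y: "smooth_on U Y"
  shows "nabla G X (\<lambda>w. \<phi> w (A (Y w) w)) u
    = pull u (\<i> *s cov (X u) (\<lambda>w. LA (Y w) w) u) + g u (Y u) (W u) *\<^sub>R A (X u) u"
proof -
  have AY: "smooth_on U (\<lambda>w. A (Y w) w)" by (rule smooth_family[OF family_A Y])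
  have LAY: "smooth_on U (\<lambda>w. LA (Y w) w)" by (rule smooth_family[OF family_LA Y])
  have gY: "smooth_on U (\<lambda>w. g w (Y w) (W w))" by (rule smooth_g[OF Y smooth_W])
  have "L (\<phi> w (A (Y w) w)) w = \<i> *s LA (Y w) w - g w (Y w) (W w) *\<^sub>R N w" if "w \<in> U" for w
    using iL[OF that, of "A (Y w) w"] by (simp add: LA_def \<eta>_def A_sym[OF that] W_def)
  then have "cov x (\<lambda>w. L (\<phi> w (A (Y w) w)) w) u
     = cov x (\<lambda>w. \<i> *s LA (Y w) w - g w (Y w) (W w) *\<^sub>R N w) u" for x
    by (rule cov_transform[OF u])
  also have "\<dots> x = \<i> *s cov x (\<lambda>w. LA (Y w) w) u
     - (dir x (\<lambda>w. g w (Y w) (W w)) u *\<^sub>R N u + g u (Y u) (W u) *\<^sub>R cov x N u)" for x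
    by (simp add: cov_diff[OF u] cov_const_smult[OF u] cov_scaleR[OF u] smooth_i LAY gY N smooth_on_scaleR[OF U])
  finally show ?thesis
    by (simp add: nabla_eq[OF u smooth_phi[OF AY]] pull_simps pull_N[OF u] pull_cov_N
       linear_scale[OF linear_pull[OF u]])
qed

end

text \<open>The structure Jacobi operator on the constant field \<open>v\<close>, as given by the Gauss equation.\<close>

definition jacobi_xi where
  "jacobi_xi v u = c *\<^sub>R (v - \<eta> v u *\<^sub>R \<xi> u) + \<alpha> u *\<^sub>R A v u - \<omega> v u *\<^sub>R W u"

lemma structure_jacobi_eq:
  assumes u: "u \<in> U"
  shows "structure_jacobi_operator c F N (\<lambda>_. v) u = jacobi_xi v u"
proof -
  let ?sf = "structure_field c F N"
  interpret g: positive_form "g u" by (rule g_positive_form[OF u])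
  have n: "nabla G X ?sf w = \<phi> w (A (X w) w)" if "w \<in> U" for X w
  proof -
    have "nabla G X ?sf w = nabla G X \<xi> w"
      by (rule nabla_cong[OF that]) (simp_all add: structure_field)
    then show ?thesis by (simp add: nabla_xi[OF that])
  qed
  have t1: "nabla G (\<lambda>_. v) (nabla G ?sf ?sf) u
      = pull u (\<i> *s cov v (\<lambda>w. LA (\<xi> w) w) u) + \<alpha> u *\<^sub>R A v u"
  proof -
    have "nabla G (\<lambda>_. v) (nabla G ?sf ?sf) u = nabla G (\<lambda>_. v) (\<lambda>w. \<phi> w (A (\<xi> w) w)) u"
      by (rule nabla_cong[OF u]) (simp_all add: n structure_field)
    then show ?thesis
      by (simp add: nabla_phi_A[OF u smooth_xi] \<alpha>_def g.sym)
  qed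
  have t2: "nabla G ?sf (nabla G (\<lambda>_. v) ?sf) u
      = pull u (\<i> *s cov (\<xi> u) (LA v) u) + \<omega> v u *\<^sub>R W u"
  proof -
    have "nabla G ?sf (nabla G (\<lambda>_. v) ?sf) u = nabla G (\<lambda>_. \<xi> u) (\<lambda>w. \<phi> w (A v w)) u"
      by (rule nabla_cong[OF u]) (simp_all add: n structure_field u)
    then show ?thesis
      using nabla_phi_A[OF u smooth_on_const, of "\<lambda>_. \<xi> u" v] by (simp add: \<omega>_def W_def)
  qed
  have t3: "nabla G (lie_bracket (\<lambda>_. v) ?sf) ?sf u = \<phi> u (A (dir v \<xi> u) u)"
  proof -
    have "lie_bracket (\<lambda>_. v) ?sf u = dir v ?sf u"
      by (simp add: lie_bracket_def dir_def)
    also have "\<dots> = dir v \<xi> u"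
      by (rule dir_transform[OF U u structure_field])
    finally show ?thesis by (simp add: n[OF u])
  qed
  \<comment> \<open>the first term on the right cancels the contribution \<open>t3\<close> of the Lie bracket\<close>
  have cx: "cov v (\<lambda>w. LA (\<xi> w) w) u = LA (dir v \<xi> u) u + cov v (LA (\<xi> u)) u"
    by (rule cov_family[OF u family_LA smooth_xi])
  have "pull u (\<i> *s cov v (LA (\<xi> u)) u) - pull u (\<i> *s cov (\<xi> u) (LA v) u)
     = c *\<^sub>R (v - \<eta> v u *\<^sub>R \<xi> u)"
    using pull_i_cov_LA_diff[OF u, of v "\<xi> u"]
    by (simp add: smult.diff_right pull_simps[OF u] \<eta>_def xi_unit[OF u])
  then show ?thesis
    unfolding structure_jacobi_operator_def jacobi_operator_def curvature_def t1 t2 t3 cx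
    by (simp add: jacobi_xi_def smult.add_right pull_simps[OF u] pull_i_LA[OF u] algebra_simps)
qed

context
  fixes u assumes u: "u \<in> U"
begin

interpretation g: positive_form "g u" by (rule g_positive_form[OF u])

lemma nabla_jacobi_xi:
  "nabla G (\<lambda>_. x) (jacobi_xi v) u = c *\<^sub>R (pull u (cov x (L v) u) - dir x (\<eta> v) u *\<^sub>R \<xi> u - \<eta> v u *\<^sub>R \<phi> u (A x u))
    + dir x \<alpha> u *\<^sub>R A v u + \<alpha> u *\<^sub>R pull u (cov x (LA v) u)
    - dir x (\<omega> v) u *\<^sub>R W u - \<omega> v u *\<^sub>R B u x"
proof -
  have smooth_jacobi: "smooth_on U (jacobi_xi v)"
    unfolding jacobi_xi_def[abs_def]
    by (intro smooth_on_add smooth_on_diff smooth_on_scaleR smooth_on_const U smooth_eta smooth_xi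
        smooth_alpha smooth_A smooth_omega smooth_W)
  have "L (jacobi_xi v w) w = (c *\<^sub>R (L v w + \<eta> v w *\<^sub>R (\<i> *s N w)) + \<alpha> w *\<^sub>R LA v w) - \<omega> v w *\<^sub>R LW w"
    if w: "w \<in> U" for w
    by (simp add: jacobi_xi_def linear_add[OF linear_L[OF w]] linear_diff[OF linear_L[OF w]]
        linear_scale[OF linear_L[OF w]] LA_def LW_def L_xi[OF w])
  then have "cov x (\<lambda>w. L (jacobi_xi v w) w) u
    = cov x (\<lambda>w. (c *\<^sub>R (L v w + \<eta> v w *\<^sub>R (\<i> *s N w)) + \<alpha> w *\<^sub>R LA v w) - \<omega> v w *\<^sub>R LW w) u"
    by (rule cov_transform[OF u])
  also have "\<dots> = c *\<^sub>R (cov x (L v) u + (dir x (\<eta> v) u *\<^sub>R (\<i> *s N u) + \<eta> v u *\<^sub>R (\<i> *s cov x N u)))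
     + (dir x \<alpha> u *\<^sub>R LA v u + \<alpha> u *\<^sub>R cov x (LA v) u) - (dir x (\<omega> v) u *\<^sub>R LW u + \<omega> v u *\<^sub>R cov x LW u)"
    by (simp add: cov_add[OF u] cov_diff[OF u] cov_scaleR[OF u] cov_const_smult[OF u]
        smooth_on_add[OF U] smooth_on_diff[OF U] smooth_on_scaleR[OF U] smooth_on_const smooth_L smooth_i N
        smooth_eta smooth_alpha smooth_omega smooth_LA smooth_LW dir_const)
  finally have eq: "cov x (\<lambda>w. L (jacobi_xi v w) w) u
    = c *\<^sub>R (cov x (L v) u + (dir x (\<eta> v) u *\<^sub>R (\<i> *s N u) + \<eta> v u *\<^sub>R (\<i> *s cov x N u)))
     + (dir x \<alpha> u *\<^sub>R LA v u + \<alpha> u *\<^sub>R cov x (LA v) u) - (dir x (\<omega> v) u *\<^sub>R LW u + \<omega> v u *\<^sub>R cov x LW u)" .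
  show ?thesis
    unfolding nabla_eq[OF u smooth_jacobi] eq
    by (simp add: pull_simps[OF u] pull_iN[OF u] pull_i_cov_N[OF u] pull_L[OF u] LA_def LW_def
        B_def algebra_simps)
qed

lemma dir_omega:
  "dir x (\<omega> v) u - dir v (\<omega> x) u = g u (B u x) v - g u (B u v) x"
proof -
  have *: "dir x (\<omega> v) u = ip c (cov x (L v) u) (LW u) + g u (B u x) v" for x v
    unfolding \<omega>_def[abs_def] g_def[of _ v] LW_def[symmetric]
    by (simp add: ip_cov[OF u] smooth_L smooth_LW B_def g_pull[OF u] ip_commute)
  show ?thesis
    unfolding *[of x v] *[of v x] unfolding LW_def ip_cov_L_sym[OF u, of x v] by simp
qed

text \<open>Unlike \<open>dir_omega\<close>, which is the symmetry of second derivatives, this rewrites \<open>\<omega> v\<close> as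
  \<open>g (A v) \<xi>\<close> and uses the Codazzi equation of the hypersurface. Together they give \<open>dW_eq\<close>.\<close>

lemma dir_omega':
  "dir x (\<omega> v) u - dir v (\<omega> x) u = 2 * g u (A (\<phi> u (A x u)) u) v - 2 * c * g u (\<phi> u x) v"
proof -
  have *: "dir x (\<omega> v) u = - ip c (cov x (LA v) u) (\<i> *s N u) + g u (\<phi> u (A x u)) (A v u)" for x v
  proof -
    have "dir x (\<omega> v) u = dir x (\<lambda>w. - ip c (LA v w) (\<i> *s N w)) u"
      by (rule dir_transform[OF U u]) (simp add: omega_eq g_def L_xi LA_def ip.minus_right)
    also have "\<dots> = - (ip c (cov x (LA v) u) (\<i> *s N u) + ip c (LA v u) (\<i> *s cov x N u))"
      by (simp add: dir_minus[OF U u] smooth_ip smooth_LA smooth_i N ip_cov[OF u] cov_const_smult[OF u])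
    also have "ip c (LA v u) (\<i> *s cov x N u) = - g u (\<phi> u (A x u)) (A v u)"
      by (simp add: i_cov_N[OF u] ip.add_right ip.diff_right ip.minus_right ip_F[OF u] phi_eq[OF u] LA_def ip_commute)
    finally show ?thesis by simp
  qed
  have "ip c (cov x (LA v) u) (\<i> *s N u) - ip c (cov v (LA x) u) (\<i> *s N u)
      = ip c (cov x (LA v) u - cov v (LA x) u) (\<i> *s N u)"
    by (simp add: ip.diff_left)
  also have "\<dots> = 2 * c * g u (\<phi> u x) v"
    unfolding cov_LA_diff[OF u] scaleR_smult[symmetric]
    by (simp add: ip.diff_left ip_F_N[OF u] smult.diff_right ip.scaleR_left ip_i_i ip_N[OF u]
        smult.scaleR_right)
  finally have "ip c (cov x (LA v) u) (\<i> *s N u) - ip c (cov v (LA x) u) (\<i> *s N u) = 2 * c * g u (\<phi> u x) v" .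
  moreover have "g u (\<phi> u (A v u)) (A x u) = - g u (\<phi> u (A x u)) (A v u)"
    using phi_skew[OF u, of "A v u" "A x u"] g.sym by simp
  moreover have "g u (\<phi> u (A x u)) (A v u) = g u (A (\<phi> u (A x u)) u) v"
    by (simp add: A_sym[OF u])
  ultimately show ?thesis
    unfolding *[of x v] *[of v x] by linarith
qed

lemma dir_alpha: "dir x \<alpha> u = g u (B u x) (\<xi> u) + g u (W u) (\<phi> u (A x u))"
proof -
  have "dir x \<alpha> u = dir x (\<lambda>w. - ip c (LW w) (\<i> *s N w)) u"
    by (rule dir_transform[OF U u]) (simp add: \<alpha>_def g_def LW_def L_xi ip.minus_right)
  also have "\<dots> = - (ip c (cov x LW u) (\<i> *s N u) + ip c (LW u) (\<i> *s cov x N u))"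
    by (simp add: dir_minus[OF U u] smooth_ip smooth_LW smooth_i N ip_cov[OF u] cov_const_smult[OF u])
  also have "ip c (LW u) (\<i> *s cov x N u) = - g u (W u) (\<phi> u (A x u))"
    unfolding g.sym[of "W u"]
    by (simp add: i_cov_N[OF u] ip.add_right ip.diff_right ip.minus_right ip_F[OF u] phi_eq[OF u] LA_def LW_def ip_commute)
  also have "ip c (cov x LW u) (\<i> *s N u) = - g u (B u x) (\<xi> u)"
    by (simp add: B_def g_pull[OF u] L_xi[OF u] ip.minus_right)
  finally show ?thesis by simp
qed

lemma linear_B: "linear (B u)"
  using linear_compose[OF linear_cov[OF u smooth_LW] linear_pull[OF u]]
  by (simp add: B_def[abs_def] o_def)

end

end

locale codazzi_chart = hypersurface_chart c U F N
  for c :: real and U :: "(real ^ 'k::finite) set"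
    and F :: "real ^ 'k \<Rightarrow> complex ^ ('n::finite option)" and N +
  assumes codazzi: "\<And>X Y u. smooth_on U X \<Longrightarrow> smooth_on U Y \<Longrightarrow> u \<in> U \<Longrightarrow>
      nabla_endo G (structure_jacobi_operator c F N) X Y u
        = nabla_endo G (structure_jacobi_operator c F N) Y X u"
begin

lemma nabla_jacobi_xi_commute:
  assumes u: "u \<in> U"
  shows "nabla G (\<lambda>_. x) (jacobi_xi y) u = nabla G (\<lambda>_. y) (jacobi_xi x) u"
proof -
  let ?R = "structure_jacobi_operator c F N"
  have "nabla G (\<lambda>_. x) (?R (\<lambda>_. y)) u = nabla G (\<lambda>_. y) (?R (\<lambda>_. x)) u"
    using codazzi[OF smooth_on_const smooth_on_const u, of x y] nabla_const_commute[of x y]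
    by (simp add: nabla_endo_def)
  moreover have "nabla G (\<lambda>_. x) (?R (\<lambda>_. y)) u = nabla G (\<lambda>_. x) (jacobi_xi y) u" for x y
    by (rule nabla_cong[OF u structure_jacobi_eq refl])
  ultimately show ?thesis by simp
qed

lemma codazzi_data:
  assumes u: "u \<in> U"
  shows "codazzi_data (g u) (\<phi> u) (\<lambda>x. A x u) (B u) (\<xi> u) c (\<lambda>x. dir x \<alpha> u)"
proof -
  interpret g: positive_form "g u" by (rule g_positive_form[OF u])
  show ?thesis
  proof (intro codazzi_data.intro codazzi_data_axioms.intro g_positive_form u c linear_phi linear_A linear_B
      linear_dir[OF U smooth_alpha u] xi_unit phi_xi phi_phi phi_skew A_sym)
    show "dir x \<alpha> u = g u (B u x) (\<xi> u) + g u (A (\<xi> u) u) (\<phi> u (A x u))" for x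
      using dir_alpha[OF u] by (simp add: W_def)
    show "g u (B u x) y - g u (B u y) x = 2 * g u (A (\<phi> u (A x u)) u) y - 2 * c * g u (\<phi> u x) y" for x y
      using dir_omega[OF u, of x y] dir_omega'[OF u, of x y] by simp
    fix x y z
    define E where "E = g u (\<phi> u (A x u)) y + g u (A (\<phi> u x) u) y"
    define P where "P = 2 * g u (A (\<phi> u (A x u)) u) y - 2 * c * g u (\<phi> u x) y"
    have "g u (\<phi> u (A y u)) x = - g u (A (\<phi> u x) u) y"
      using phi_skew[OF u, of "A y u" x] A_sym[OF u] g.sym by simp
    then have E: "dir x (\<eta> y) u = dir y (\<eta> x) u + E"
      using dir_eta[OF u, of x y] by (simp add: E_def)
    have P: "dir x (\<omega> y) u = dir y (\<omega> x) u + P"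
      using dir_omega'[OF u, of x y] by (simp add: P_def)
    have C: "pull u (cov x (LA y) u) = pull u (cov y (LA x) u)
      - (2 * c * g u (\<phi> u x) y) *\<^sub>R \<xi> u - c *\<^sub>R (\<eta> y u *\<^sub>R \<phi> u x - \<eta> x u *\<^sub>R \<phi> u y)"
      using pull_cov_LA_diff[OF u, of x y] by (simp add: algebra_simps)
    \<comment> \<open>\<open>E\<close>, \<open>P\<close>, \<open>C\<close> and \<open>S\<close> are the antisymmetric parts of the derivatives of \<open>\<eta>\<close>, \<open>\<omega>\<close>, \<open>L A\<close> and \<open>L\<close>\<close>
    have S: "pull u (cov x (L y) u) = pull u (cov y (L x) u)"
      unfolding pull_eq_iff[OF u] using ip_cov_L_sym[OF u] by blast
    have "nabla G (\<lambda>_. x) (jacobi_xi y) u - nabla G (\<lambda>_. y) (jacobi_xi x) u = 0"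
      using nabla_jacobi_xi_commute[OF u, of x y] by simp
    then have "- (c * E) *\<^sub>R \<xi> u - c *\<^sub>R (\<eta> y u *\<^sub>R \<phi> u (A x u) - \<eta> x u *\<^sub>R \<phi> u (A y u))
      + dir x \<alpha> u *\<^sub>R A y u - dir y \<alpha> u *\<^sub>R A x u
      + (\<alpha> u * c) *\<^sub>R (\<eta> x u *\<^sub>R \<phi> u y - \<eta> y u *\<^sub>R \<phi> u x - (2 * g u (\<phi> u x) y) *\<^sub>R \<xi> u)
      - P *\<^sub>R W u - \<omega> y u *\<^sub>R B u x + \<omega> x u *\<^sub>R B u y = 0"
      unfolding nabla_jacobi_xi[OF u] E P C S by (simp add: algebra_simps)
    then have "g u (- (c * E) *\<^sub>R \<xi> u - c *\<^sub>R (\<eta> y u *\<^sub>R \<phi> u (A x u) - \<eta> x u *\<^sub>R \<phi> u (A y u))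
      + dir x \<alpha> u *\<^sub>R A y u - dir y \<alpha> u *\<^sub>R A x u
      + (\<alpha> u * c) *\<^sub>R (\<eta> x u *\<^sub>R \<phi> u y - \<eta> y u *\<^sub>R \<phi> u x - (2 * g u (\<phi> u x) y) *\<^sub>R \<xi> u)
      - P *\<^sub>R W u - \<omega> y u *\<^sub>R B u x + \<omega> x u *\<^sub>R B u y) z = 0"
      by (simp add: g.left_simps)
    then show "- c * (g u (\<phi> u (A x u)) y + g u (A (\<phi> u x) u) y) * g u (\<xi> u) z
      - c * (g u y (\<xi> u) * g u (\<phi> u (A x u)) z - g u x (\<xi> u) * g u (\<phi> u (A y u)) z)
      + dir x \<alpha> u * g u (A y u) z - dir y \<alpha> u * g u (A x u) z
      + g u (A (\<xi> u) u) (\<xi> u) * c * (g u x (\<xi> u) * g u (\<phi> u y) z - g u y (\<xi> u) * g u (\<phi> u x) z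
           - 2 * g u (\<phi> u x) y * g u (\<xi> u) z)
      - (2 * g u (A (\<phi> u (A x u)) u) y - 2 * c * g u (\<phi> u x) y) * g u (A (\<xi> u) u) z
      - g u y (A (\<xi> u) u) * g u (B u x) z + g u x (A (\<xi> u) u) * g u (B u y) z = 0"
      by (simp only: g.left_simps E_def[symmetric] P_def[symmetric] \<eta>_def \<omega>_def \<alpha>_def W_def real_scaleR_def) simp
  qed
qed

end


section \<open>Charts with structure Jacobi operator of Codazzi type\<close>

text \<open>Used to find tangent vectors orthogonal to \<open>\<xi>\<close>, \<open>T\<close> and \<open>\<phi> T\<close>; this is where the dimension of the
  hypersurface enters.\<close>

lemma common_zero:
  fixes f1 f2 f3 :: "real ^ 'k::finite \<Rightarrow> real"
  assumes "linear f1" "linear f2" "linear f3" and "CARD('k) > 3"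
  obtains x where "x \<noteq> 0" "f1 x = 0" "f2 x = 0" "f3 x = 0"
proof -
  let ?h = "\<lambda>x. (f1 x, f2 x, f3 x)"
  have lin: "linear ?h"
    using assms(1-3) by (auto intro!: linearI simp: linear_add linear_scale)
  have "\<not> inj ?h"
  proof
    assume "inj ?h"
    then have "dim (range ?h) = CARD('k)"
      using dim_image_eq[OF lin, of UNIV] by simp
    moreover have "dim (range ?h) \<le> 3"
      using dim_subset_UNIV[of "range ?h"] by simp
    ultimately show False using assms(4) by simp
  qed
  then show ?thesis
    using that unfolding linear_injective_0[OF lin] by (auto simp: zero_prod_def)
qed

context codazzi_chart
begin

definition T where "T u = W u - \<alpha> u *\<^sub>R \<xi> u"

lemma smooth_T: "smooth_on U T"
  unfolding T_def[abs_def]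
  by (intro smooth_on_diff smooth_on_scaleR U smooth_W smooth_alpha smooth_xi)

text \<open>The one-form \<open>g (\<phi> W)\<close>, evaluated on constant fields; \<open>dir_zeta\<close> is its exterior derivative.\<close>

definition \<zeta> where "\<zeta> x u = g u (\<phi> u (W u)) x"

lemma smooth_zeta: "smooth_on U (\<zeta> x)"
  unfolding \<zeta>_def[abs_def] by (intro smooth_g smooth_phi smooth_W smooth_on_const)

lemma dir_zeta:
  assumes u: "u \<in> U"
  shows "dir x (\<zeta> y) u - dir y (\<zeta> x) u
    = g u (\<phi> u (B u x)) y - g u (\<phi> u (B u y)) x - g u (W u) (A x u) * \<eta> y u + g u (W u) (A y u) * \<eta> x u"
proof -
  have *: "dir x (\<zeta> y) u = g u (\<phi> u (B u x)) y - g u (W u) (A x u) * \<eta> y u + ip c (\<i> *s LW u) (cov x (L y) u)" for x y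
  proof -
    have "dir x (\<zeta> y) u = dir x (\<lambda>w. ip c (\<i> *s LW w) (L y w)) u"
      by (rule dir_transform[OF U u]) (simp add: \<zeta>_def phi_eq LW_def)
    also have "\<dots> = ip c (\<i> *s cov x LW u) (L y u) + ip c (\<i> *s LW u) (cov x (L y) u)"
      by (simp add: ip_cov[OF u] smooth_i smooth_LW smooth_L cov_const_smult[OF u])
    also have "ip c (\<i> *s cov x LW u) (L y u) = g u (\<phi> u (B u x)) y - g u (W u) (A x u) * \<eta> y u"
    proof -
      have "dir x (\<lambda>w. ip c (LW w) (N w)) u = dir x (\<lambda>w. 0) u"
        by (rule dir_transform[OF U u]) (simp add: LW_def ip_N)
      then have "ip c (cov x LW u) (N u) + ip c (LW u) (cov x N u) = 0"
        by (simp add: ip_cov[OF u smooth_LW N] dir_const)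
      moreover have "ip c (LW u) (cov x N u) = - g u (W u) (A x u)"
        using ip_cov_N[OF u, of x "W u"] ip_commute[of c "L (W u) u" "cov x N u"]
          positive_form.sym[OF g_positive_form[OF u], of "W u" "A x u"]
        by (simp add: LW_def)
      ultimately have n: "ip c (cov x LW u) (N u) = g u (W u) (A x u)"
        by simp
      have "cov x LW u = L (B u x) u + g u (W u) (A x u) *\<^sub>R N u + (of_real c * herm c (cov x LW u) (F u)) *s F u"
        using decompose_frame[OF u, of "cov x LW u"] by (simp add: n B_def)
      then have "ip c (\<i> *s cov x LW u) (L y u) = ip c (\<i> *s (L (B u x) u + g u (W u) (A x u) *\<^sub>R N u
          + (of_real c * herm c (cov x LW u) (F u)) *s F u)) (L y u)"
        by metis
      also have "\<dots> = g u (\<phi> u (B u x)) y + g u (W u) (A x u) * ip c (\<i> *s N u) (L y u)"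
        by (simp add: smult.add_right smult.scaleR_right smult_smult ip.add_left ip.scaleR_left ip_F[OF u]
            phi_eq[OF u] del: vector_smult_assoc)
      also have "ip c (\<i> *s N u) (L y u) = - \<eta> y u"
        by (simp add: eta_eq[OF u] ip_commute)
      finally show ?thesis by simp
    qed
    finally show ?thesis .
  qed
  have "ip c (\<i> *s LW u) (cov x (L y) u) = ip c (\<i> *s LW u) (cov y (L x) u)"
  proof -
    have "\<i> *s LW u = L (\<phi> u (W u)) u + \<eta> (W u) u *\<^sub>R N u"
      by (simp add: LW_def iL[OF u])
    moreover have "ip c (N u) (cov x (L y) u) = ip c (N u) (cov y (L x) u)"
    proof -
      have "cov x (L y) u = cov y (L x) u + \<rho> x y u *s F u"
        using cov_L_sym[OF u, of x y] by (simp add: algebra_simps)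
      then show ?thesis by (simp add: ip.add_right ip_F_N[OF u])
    qed
    ultimately show ?thesis
      using ip_cov_L_sym[OF u, of x y "\<phi> u (W u)"]
      by (simp add: ip.add_left ip.scaleR_left ip_commute[of c "L (\<phi> u (W u)) u"])
  qed
  then show ?thesis
    unfolding *[of x y] *[of y x] by simp
qed

text \<open>On the whole chart \<open>W = \<alpha> \<xi>\<close>, and differentiating \<open>L W = - \<alpha> \<i> N\<close> determines \<open>B\<close>.\<close>

lemma Hopf_contradiction:
  assumes u: "u \<in> U" and T: "\<And>w. w \<in> U \<Longrightarrow> T w = 0" and card_k: "CARD('k) > 3"
  shows False
proof -
  interpret D: codazzi_data "g u" "\<phi> u" "\<lambda>x. A x u" "B u" "\<xi> u" c "\<lambda>x. dir x \<alpha> u"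
    by (rule codazzi_data[OF u])
  have W: "D.W = W u" "D.\<alpha> = \<alpha> u"
    by (simp_all add: D.W_def W_def D.\<alpha>_def \<alpha>_def)
  have "B u x = dir x \<alpha> u *\<^sub>R \<xi> u + \<alpha> u *\<^sub>R \<phi> u (A x u)" for x
  proof -
    have "LW w = - (\<alpha> w *\<^sub>R (\<i> *s N w))" if "w \<in> U" for w
    proof -
      have "W w = \<alpha> w *\<^sub>R \<xi> w" using T[OF that] by (simp add: T_def)
      then show ?thesis
        by (simp add: LW_def linear_scale[OF linear_L[OF that]] L_xi[OF that])
    qed
    then have "cov x LW u = cov x (\<lambda>w. - (\<alpha> w *\<^sub>R (\<i> *s N w))) u"
      by (rule cov_transform[OF u])
    also have "\<dots> = - (dir x \<alpha> u *\<^sub>R (\<i> *s N u) + \<alpha> u *\<^sub>R (\<i> *s cov x N u))"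
      by (simp add: cov_minus[OF u] cov_scaleR[OF u] cov_const_smult[OF u] smooth_on_scaleR[OF U] smooth_alpha
          smooth_i N)
    finally show ?thesis
      by (simp add: B_def pull_simps[OF u] pull_iN[OF u] pull_i_cov_N[OF u])
  qed
  moreover have "D.T = 0"
    using T[OF u] by (simp add: D.T_def W T_def)
  ultimately interpret H: Hopf_data "g u" "\<phi> u" "\<lambda>x. A x u" "B u" "\<xi> u" c "\<lambda>x. dir x \<alpha> u"
    by unfold_locales (simp_all add: W)
  obtain x where "x \<noteq> 0" "g u x (\<xi> u) = 0"
    using common_zero[OF D.linear_left D.linear_left D.linear_left card_k] by metis
  then show False
    using H.orthogonal_vector_zero by blast
qed

text \<open>On the open set where \<open>T\<close> does not vanish, \<open>\<alpha>\<^sup>2 = 1\<close>; so \<open>\<alpha>\<close> has zero derivative there. The function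
  \<open>q = g W W\<close> then satisfies \<open>dq = - 2 (2 q - 1) \<zeta>\<close>. In the antisymmetric part of its second
  derivatives, the terms quadratic in \<open>\<zeta>\<close> cancel, so \<open>\<zeta>\<close> is closed, in contradiction to
  \<open>d_phi_W_nonzero\<close>.\<close>

lemma non_Hopf_contradiction:
  assumes u: "u \<in> U" and T: "T u \<noteq> 0" and card_k: "CARD('k) > 3"
  shows False
proof -
  define Q where "Q = {w \<in> U. T w \<noteq> 0}"
  have Q: "open Q" "u \<in> Q" "Q \<subseteq> U"
    using continuous_open_preimage[OF smooth_on_continuous[OF smooth_T] U, of "- {0}"] u T
    by (auto simp: Q_def Int_def vimage_def)
  have data: "codazzi_data.W (\<lambda>x. A x w) (\<xi> w) = W w"
    "codazzi_data.\<alpha> (g w) (\<lambda>x. A x w) (\<xi> w) = \<alpha> w"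
    "codazzi_data.T (g w) (\<lambda>x. A x w) (\<xi> w) = T w"
    if "w \<in> U" for w
    using codazzi_data[OF that]
    by (simp_all add: codazzi_data.T_def codazzi_data.\<alpha>_def codazzi_data.W_def W_def \<alpha>_def T_def)
  have non_Hopf: "non_Hopf_data (g w) (\<phi> w) (\<lambda>x. A x w) (B w) (\<xi> w) c (\<lambda>x. dir x \<alpha> w)" if "w \<in> Q" for w
  proof -
    have "w \<in> U" "T w \<noteq> 0" using that by (auto simp: Q_def)
    then show ?thesis
      using data[of w] codazzi_data[of w] by (intro non_Hopf_data.intro non_Hopf_data_axioms.intro) simp_all
  qed
  have c_alpha: "c = 1" "\<alpha> w * \<alpha> w = 1" if w: "w \<in> Q" for w
  proof -
    interpret D: non_Hopf_data "g w" "\<phi> w" "\<lambda>x. A x w" "B w" "\<xi> w" c "\<lambda>x. dir x \<alpha> w"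
      by (rule non_Hopf[OF w])
    obtain x where "x \<noteq> 0" "x \<in> D.D"
      unfolding D.D_def
      using common_zero[OF D.linear_left D.linear_left D.linear_left card_k, of "\<xi> w" D.T D.V] by blast
    then show "c = 1" "\<alpha> w * \<alpha> w = 1"
      using D.c_alpha data(2)[of w] w Q by auto
  qed
  have d_alpha: "dir x \<alpha> w = 0" if w: "w \<in> Q" for x w
  proof -
    have s: "smooth_on Q \<alpha>" by (rule smooth_on_subset[OF smooth_alpha Q(3)])
    have "dir x (\<lambda>w. \<alpha> w * \<alpha> w) w = dir x (\<lambda>w. 1) w"
      by (rule dir_transform[OF Q(1) w]) (rule c_alpha(2))
    then have "\<alpha> w * dir x \<alpha> w = 0"
      by (simp add: bounded_bilinear.dir[OF bounded_bilinear_mult Q(1) w s s] dir_const)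
    then show ?thesis
      using c_alpha(2)[OF w] by auto
  qed
  have constant_alpha_data: "non_Hopf_constant_data (g w) (\<phi> w) (\<lambda>x. A x w) (B w) (\<xi> w) c (\<lambda>x. dir x \<alpha> w)" if w: "w \<in> Q" for w
  proof -
    interpret D: non_Hopf_data "g w" "\<phi> w" "\<lambda>x. A x w" "B w" "\<xi> w" c "\<lambda>x. dir x \<alpha> w"
      by (rule non_Hopf[OF w])
    show ?thesis
      by unfold_locales (use c_alpha[OF w] d_alpha[OF w] D.A_eq_on_D data(2)[of w] w Q in auto)
  qed
  define q where "q w = g w (W w) (W w)" for w
  have smooth_q: "smooth_on U q"
    unfolding q_def[abs_def] by (intro smooth_g smooth_W)
  have dq: "dir x q w = - (2 * (2 * q w - 1)) * \<zeta> x w" and q_pos: "2 * q w - 1 > 0" if w: "w \<in> Q" for x w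
  proof -
    interpret D: non_Hopf_constant_data "g w" "\<phi> w" "\<lambda>x. A x w" "B w" "\<xi> w" c "\<lambda>x. dir x \<alpha> w"
      by (rule constant_alpha_data[OF w])
    have wU: "w \<in> U" using w Q by blast
    have q: "2 * q w - 1 = 1 + 2 * D.b"
      using D.W_W D.alpha_sq by (simp add: q_def data(1)[OF wU])
    then show "2 * q w - 1 > 0"
      using D.b_pos by simp
    have "dir x q w = dir x (\<lambda>w. ip c (LW w) (LW w)) w"
      by (simp add: q_def[abs_def] g_def LW_def[abs_def])
    also have "\<dots> = ip c (cov x LW w) (LW w) + ip c (LW w) (cov x LW w)"
      by (rule ip_cov[OF wU smooth_LW smooth_LW])
    also have "\<dots> = 2 * ip c (cov x LW w) (LW w)"
      by (simp add: ip_commute)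
    also have "\<dots> = 2 * g w (B w x) (W w)"
      by (simp add: B_def g_pull[OF wU] LW_def)
    also have "\<dots> = - (2 * (2 * q w - 1)) * \<zeta> x w"
      using D.B_W[of x] unfolding q by (simp add: data(1)[OF wU] \<zeta>_def D.V_def)
    finally show "dir x q w = - (2 * (2 * q w - 1)) * \<zeta> x w" .
  qed
  have symmetric: "dir x (\<zeta> y) u = dir y (\<zeta> x) u" for x y
  proof -
    have *: "dir x (dir y q) u = - 2 * (2 * q u - 1) * dir x (\<zeta> y) u + 8 * (2 * q u - 1) * \<zeta> x u * \<zeta> y u" for x y
    proof -
      have s: "smooth_on Q (\<lambda>w. 2 * q w - 1)" "smooth_on Q q" "smooth_on Q (\<zeta> y)"
        by (intro smooth_on_diff smooth_on_mult smooth_on_const smooth_on_subset[OF smooth_q Q(3)]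
            smooth_on_subset[OF smooth_zeta Q(3)] Q(1))+
      have "dir x (dir y q) u = dir x (\<lambda>w. (- 2) * ((2 * q w - 1) * \<zeta> y w)) u"
        by (rule dir_transform[OF Q(1,2)]) (simp add: dq algebra_simps)
      also have "\<dots> = (- 2) * ((2 * q u - 1) * dir x (\<zeta> y) u + 2 * dir x q u * \<zeta> y u)"
        using s by (simp add: bounded_bilinear.dir[OF bounded_bilinear_mult Q(1,2)] smooth_on_const dir_const
           dir_diff[OF Q(1,2)] dir_minus[OF Q(1,2)] smooth_on_mult[OF Q(1)])
      finally show ?thesis
        by (simp add: dq[OF Q(2)] algebra_simps)
    qed
    have "(2 * q u - 1) * dir x (\<zeta> y) u = (2 * q u - 1) * dir y (\<zeta> x) u"
      using dir_commute[OF U u smooth_q, of x y] unfolding *[of x y] *[of y x] by simp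
    then show ?thesis
      using q_pos[OF Q(2)] by simp
  qed
  interpret D: non_Hopf_constant_data "g u" "\<phi> u" "\<lambda>x. A x u" "B u" "\<xi> u" c "\<lambda>x. dir x \<alpha> u"
    by (rule constant_alpha_data[OF Q(2)])
  have "g u (\<phi> u (B u (\<xi> u))) (T u) - g u (\<phi> u (B u (T u))) (\<xi> u) + g u (W u) (A (T u) u) = 0"
    using dir_zeta[OF u, of "\<xi> u" "T u"] symmetric D.T_xi data[OF u] D.xi_unit by (simp add: \<eta>_def)
  then show False
    using D.d_phi_W_nonzero data[OF u] by simp
qed

lemma no_codazzi_chart:
  assumes "U \<noteq> {}" "CARD('n) > 2"
  shows False
proof -
  have card_k: "CARD('k) > 3" using card assms(2) by simp
  obtain u where "u \<in> U" using assms(1) by blast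
  then show False
    using Hopf_contradiction[OF _ _ card_k] non_Hopf_contradiction[OF _ _ card_k] by blast
qed

end


section \<open>Unit normals and restriction of charts\<close>

text \<open>A fixed vector outside the span of the tangent space and the complex line of \<open>F\<close> at the given point is
  projected to the normal direction at the nearby points and normalised.\<close>

lemma (in immersion) local_unit_normal:
  assumes u: "u \<in> U" and card: "CARD('k) + 1 = 2 * CARD('n)"
  obtains V N where "open V" "u \<in> V" "V \<subseteq> U" "unit_normal_field c V F N"
proof -
  define \<Phi> where "\<Phi> = (\<lambda>(v, z :: complex). L v u + z *s F u)"
  have lin: "linear \<Phi>"
    using linear_add[OF linear_L[OF u]] linear_scale[OF linear_L[OF u]]
    by (auto intro!: linearI simp: \<Phi>_def smult.add_left smult.scaleR_left algebra_simps)
  have "dim (range \<Phi>) \<le> CARD('k) + 2"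
    using dim_image_le[OF lin, of UNIV] by simp
  then have "dim (range \<Phi>) < dim (UNIV :: (complex ^ ('n option)) set)"
    using card by (simp add: card_option)
  then have "range \<Phi> \<noteq> UNIV"
    by auto
  then obtain s where s: "s \<notin> range \<Phi>"
    by blast
  define n where "n w = s - L (pull w s) w - (of_real c * herm c s (F w)) *s F w" for w
  have smooth_n: "smooth_on U n"
    unfolding n_def[abs_def]
    by (intro smooth_on_diff U smooth_on_const smooth_family[OF family_L] smooth_pull smooth_smult
        smooth_on_mult smooth_herm F)
  have n_F: "herm c (n w) (F w) = 0" if "w \<in> U" for w
    using c_sq by (simp add: n_def herm.diff_left herm_smult_left herm_L_F[OF that] herm_F_F[OF that] mult.left_commute
      mult.commute)
  have n_L: "ip c (n w) (L y w) = 0" if "w \<in> U" for w y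
    using g_pull(1)[OF that, of s y] by (simp add: n_def ip.diff_left ip_F[OF that] g_def)
  define q where "q w = ip c (n w) (n w)" for w
  have smooth_q: "smooth_on U q"
    unfolding q_def[abs_def] by (intro smooth_ip smooth_n)
  define V where "V = {w \<in> U. q w > 0}"
  have V: "open V" "V \<subseteq> U"
    using continuous_open_preimage[OF smooth_on_continuous[OF smooth_q] U, of "{0<..}"]
    by (auto simp: V_def Int_def vimage_def)
  have "n u \<noteq> 0"
  proof
    assume "n u = 0"
    then have "s = \<Phi> (pull u s, of_real c * herm c s (F u))"
      by (simp add: n_def \<Phi>_def algebra_simps)
    then show False using s by blast
  qed
  then have "u \<in> V"
    using horizontal_positive[OF c herm_F_F[OF u] n_F[OF u]] u by (simp add: V_def q_def)
  define N where "N w = inverse (sqrt (q w)) *\<^sub>R n w" for w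
  have "smooth_on V N"
    unfolding N_def[abs_def] using V
    by (intro smooth_on_scaleR smooth_on_inverse smooth_on_sqrt smooth_on_subset[OF smooth_q]
        smooth_on_subset[OF smooth_n]) (auto simp: V_def)
  moreover have "N w \<in> horizontal_space c (F w)" "Re (herm c (N w) (N w)) = 1"
    "Re (herm c (N w) (differential c F w v)) = 0" if "w \<in> V" for w v
  proof -
    have w: "w \<in> U" "q w > 0" using that by (auto simp: V_def)
    show "N w \<in> horizontal_space c (F w)"
      by (simp add: N_def horizontal_space_def herm.scaleR_left n_F w)
    have "ip c (N w) (N w) = inverse (sqrt (q w)) * inverse (sqrt (q w)) * q w"
      by (simp add: N_def ip.scaleR_left ip.scaleR_right q_def)
    also have "\<dots> = 1"
      using w(2) by (simp flip: inverse_mult_distrib)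
    finally show "Re (herm c (N w) (N w)) = 1"
      by (simp add: ip_def)
    show "Re (herm c (N w) (differential c F w v)) = 0"
      using n_L[OF w(1), of v] by (simp add: N_def herm.scaleR_left L_def ip_def)
  qed
  ultimately have "unit_normal_field c V F N"
    by (simp add: unit_normal_field_def)
  then show ?thesis
    using that V \<open>u \<in> V\<close> by blast
qed

lemma local_parametrization_subset:
  assumes P: "local_parametrization c M f U x F" and V: "open V" "V \<subseteq> U"
  shows "local_parametrization c M f V x F"
proof -
  have hom: "homeomorphic_map (top_of_set U) (subtopology M (x ` U)) x" and op: "openin M (x ` U)"
    using P by (simp_all add: local_parametrization_def)
  have xU: "topspace (subtopology M (x ` U)) = x ` U"
    using openin_subset[OF op] by auto
  have "openin (subtopology M (x ` U)) (x ` V)"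
    using homeomorphic_map_openness[OF hom, of V] V open_subset[OF V(2,1)] by simp
  then have opV: "openin M (x ` V)"
    using op openin_open_subtopology by blast
  have "homeomorphic_map (subtopology (top_of_set U) V) (subtopology (subtopology M (x ` U)) (x ` V)) x"
    by (rule homeomorphic_map_subtopologies[OF hom]) (use V xU in auto)
  then have "homeomorphic_map (top_of_set V) (subtopology M (x ` V)) x"
    using V(2) by (simp add: subtopology_subtopology Int_absorb1 image_mono)
  then show ?thesis
    using P V opV smooth_on_subset[of U F V] by (auto simp: local_parametrization_def)
qed

theorem theorem5:
  fixes c :: real
  assumes "c = 1 \<or> c = -1" and "CARD('n::finite) > 2"
  shows "\<not> (\<exists>(M :: 'a topology) (f :: 'a \<Rightarrow> (complex ^ ('n option)) set).
           real_hypersurface TYPE('k::finite) c M f \<and> codazzi_structure_jacobi TYPE('k) c M f)"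
proof
  assume "\<exists>(M :: 'a topology) (f :: 'a \<Rightarrow> (complex ^ ('n option)) set).
           real_hypersurface TYPE('k) c M f \<and> codazzi_structure_jacobi TYPE('k) c M f"
  then obtain M :: "'a topology" and f :: "'a \<Rightarrow> (complex ^ ('n option)) set"
    where M: "real_hypersurface TYPE('k) c M f" and cod: "codazzi_structure_jacobi TYPE('k) c M f"
    by blast
  have card: "CARD('k) + 1 = 2 * CARD('n)"
    using M by (simp add: real_hypersurface_def)
  obtain p where "p \<in> topspace M"
    using M unfolding real_hypersurface_def by blast
  then obtain U x and F :: "real ^ 'k \<Rightarrow> complex ^ ('n option)"
    where P: "local_parametrization c M f U x F" and "p \<in> x ` U"
    using M unfolding real_hypersurface_def by meson
  then obtain u where u: "u \<in> U" by blast
  have "immersion c U F"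
    using P assms(1) by (intro immersion.intro) (auto simp: local_parametrization_def)
  from immersion.local_unit_normal[OF this u card]
  obtain V N where V: "open V" "u \<in> V" "V \<subseteq> U" and N: "unit_normal_field c V F N" by blast
  have PV: "local_parametrization c M f V x F"
    by (rule local_parametrization_subset[OF P V(1,3)])
  have "immersion c V F"
    using PV assms(1) by (intro immersion.intro) (auto simp: local_parametrization_def)
  moreover have "nabla_endo (induced_metric c F) (structure_jacobi_operator c F N) X Y w
      = nabla_endo (induced_metric c F) (structure_jacobi_operator c F N) Y X w"
    if "smooth_on V X" "smooth_on V Y" "w \<in> V" for X Y w
    using cod PV N that unfolding codazzi_structure_jacobi_def by blast
  ultimately have "codazzi_chart c V F N"
    using card N by (intro codazzi_chart.intro hypersurface_chart.intro hypersurface_chart_axioms.intro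
        codazzi_chart_axioms.intro)
  then show False
    using codazzi_chart.no_codazzi_chart V(2) assms(2) by blast
qed

end
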